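(* Assume $S_1$ and $S_2$ are spherical rigid bodies ($C_1=A_1$, $C_2=A_2$). Let $Z>0$ and let $\mathbf z_e$ be the (equilateral) Lagrangian relative equilibrium $$\lambda^e=(x_1,y_1,0),\quad p_\lambda^e=g_1\omega_0^e(-y_1,x_1,0),\quad \mu^e=(x_2,y_2,0),\quad p_\mu^e=g_2\omega_0^e(-y_2,x_2,0),$$ $$\Omega_0^e=(0,0,\omega_0^e),\quad \Pi_0^e=(0,0,C_0\omega_0^e+l),\quad \Pi_i^e\times\Omega_i^e=0\ (i=1,2),$$ $$x_1=Z,\quad y_1=0,\quad x_2=\frac{Z(m_2-m_1)}{2(m_1+m_2)},\quad y_2=\pm\frac{\sqrt3Z}2,\quad (\omega_0^e)^2=\frac{G(m_0+m_1+m_2)}{Z^3}.$$ Then $\mathbf z_e$ is spectrally stable if $$(m_0+m_2+m_1)^2\ge27(m_1m_0+m_2m_0+m_1m_2),$$ and if $$(m_0+m_2+m_1)^2<27(m_1m_0+m_2m_0+m_1m_2)$$ then $\mathbf z_e$ is unstable.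
   Context: Setting. $G>0$; $m_0,m_1,m_2>0$ are the masses of a gyrostat $S_0$ and two symmetric rigid bodies $S_1,S_2$. Put $M_2=m_1+m_2$, $M_1=m_0+m_1+m_2$, $g_1=m_1m_2/M_2$, $g_2=m_0M_2/M_1$. Inertia tensors: $\mathbb I_i=\mathrm{diag}(A_i,A_i,C_i)$, $A_i,C_i>0$, $i=0,1,2$. The gyrostatic momentum is the constant vector $l_r=(0,0,l)$. The state is $\mathbf z=(\Pi_1,\Pi_2,\Pi_0,\lambda,p_\lambda,\mu,p_\mu)\in\mathbb R^{21}$ (seven vectors of $\mathbb R^3$), with $\Pi_0=\mathbb I_0\Omega_0+l_r$ and $\Pi_i=\mathbb I_i\Omega_i$ ($i=1,2$). When $C_1=A_1$, $C_2=A_2$ the potential is $$\mathcal V=-\Big(\frac{Gm_1m_2}{|\lambda|}+\frac{Gm_1m_0}{|\mu-\frac{m_2}{M_2}\lambda|}+\frac{Gm_2m_0}{|\mu+\frac{m_1}{M_2}\lambda|}\Big).$$ The equations of motion are $$\dot\Pi_0=\Pi_0\times\Omega_0+\lambda\times\nabla_\lambda\mathcal V+\mu\times\nabla_\mu\mathcal V,$$ $$\dot\lambda=\frac{p_\lambda}{g_1}+\lambda\times\Omega_0,\quad \dot p_\lambda=p_\lambda\times\Omega_0-\nabla_\lambda\mathcal V,\quad \dot\mu=\frac{p_\mu}{g_2}+\mu\times\Omega_0,\quad \dot p_\mu=p_\mu\times\Omega_0-\nabla_\mu\mathcal V,$$ $$\dot\Pi_1=\Pi_1\times\Omega_1,\quad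 \dot\Pi_2=\Pi_2\times\Omega_2 .$$ A relative equilibrium is an equilibrium point of these equations; it is Lagrangian if $\lambda^e,\mu^e$ are not proportional and $\Omega_0^e$ is perpendicular to the plane they generate. $\mathbf z_e$ is spectrally stable if all eigenvalues of the Jacobian matrix $\mathfrak U(\mathbf z_e)$ of the equations of motion at $\mathbf z_e$ have zero real part. *)

theory Defs
  imports "HOL-Analysis.Analysis"
begin

unbundle cross3_syntax

text \<open>The state space \<open>\<real>\<^sup>2\<^sup>1\<close> is \<open>\<real>\<close> to the power of the index set \<open>block \<times> 3\<close>: seven blocks of
  three coordinates each. In this way the Jacobian matrix is the library's
  \<^term>\<open>matrix (frechet_derivative f (at z))\<close>.\<close>

datatype block = Pi1 | Pi2 | Pi0 | Lam | PLam | Mu | PMu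

instance block :: finite
proof
  have "(UNIV :: block set) = {Pi1, Pi2, Pi0, Lam, PLam, Mu, PMu}"
    using block.exhaust by auto
  then show "finite (UNIV :: block set)"
    by (metis finite.emptyI finite.insertI)
qed

type_synonym state = "real ^ (block \<times> 3)"

definition blk :: "state \<Rightarrow> block \<Rightarrow> real ^ 3" where
  "blk z k = (\<chi> j. z $ (k, j))"

definition of_blocks :: "(block \<Rightarrow> real ^ 3) \<Rightarrow> state" where
  "of_blocks v = (\<chi> p. v (fst p) $ snd p)"

definition inertia :: "real \<Rightarrow> real \<Rightarrow> real ^ 3 ^ 3" where
  "inertia A C = (\<chi> i j. if i = j then vector [A, A, C] $ i else 0)"

definition gyr_momentum :: "real \<Rightarrow> real ^ 3" where
  "gyr_momentum l = vector [0, 0, l]"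

text \<open>Angular velocities, solved from \<open>\<Pi>\<^sub>0 = \<I>\<^sub>0 \<Omega>\<^sub>0 + l\<^sub>r\<close> and \<open>\<Pi>\<^sub>i = \<I>\<^sub>i \<Omega>\<^sub>i\<close>.\<close>

definition Omega_gyro :: "real \<Rightarrow> real \<Rightarrow> real \<Rightarrow> real ^ 3 \<Rightarrow> real ^ 3" where
  "Omega_gyro A C l P = matrix_inv (inertia A C) *v (P - gyr_momentum l)"

definition Omega_rigid :: "real \<Rightarrow> real \<Rightarrow> real ^ 3 \<Rightarrow> real ^ 3" where
  "Omega_rigid A C P = matrix_inv (inertia A C) *v P"

text \<open>The potential for spherical \<open>S\<^sub>1\<close>, \<open>S\<^sub>2\<close>, i.e. \<open>C\<^sub>1 = A\<^sub>1\<close> and \<open>C\<^sub>2 = A\<^sub>2\<close>.\<close>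

definition potential ::
  "real \<Rightarrow> real \<Rightarrow> real \<Rightarrow> real \<Rightarrow> real ^ 3 \<Rightarrow> real ^ 3 \<Rightarrow> real" where
  "potential G m0 m1 m2 lam mu =
     - (G * m1 * m2 / norm lam
        + G * m1 * m0 / norm (mu - (m2 / (m1 + m2)) *\<^sub>R lam)
        + G * m2 * m0 / norm (mu + (m1 / (m1 + m2)) *\<^sub>R lam))"

text \<open>The gradient is unspecified where the function is not differentiable, which for
  the potential means at collisions only.\<close>

definition grad :: "(real ^ 3 \<Rightarrow> real) \<Rightarrow> real ^ 3 \<Rightarrow> real ^ 3" where
  "grad f x = (THE D. GDERIV f x :> D)"

definition eq_motion ::
  "real \<Rightarrow> real \<Rightarrow> real \<Rightarrow> real \<Rightarrow> real \<Rightarrow> real \<Rightarrow> real \<Rightarrow> real \<Rightarrow> real \<Rightarrow> real \<Rightarrow> real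
     \<Rightarrow> state \<Rightarrow> state" where
  "eq_motion G m0 m1 m2 A0 C0 A1 C1 A2 C2 l z =
    (let g1 = m1 * m2 / (m1 + m2);
         g2 = m0 * (m1 + m2) / (m0 + m1 + m2);
         lam = blk z Lam; plam = blk z PLam; mu = blk z Mu; pmu = blk z PMu;
         \<Omega>0 = Omega_gyro A0 C0 l (blk z Pi0);
         \<Omega>1 = Omega_rigid A1 C1 (blk z Pi1);
         \<Omega>2 = Omega_rigid A2 C2 (blk z Pi2);
         dlam = grad (\<lambda>u. potential G m0 m1 m2 u mu) lam;
         dmu = grad (\<lambda>u. potential G m0 m1 m2 lam u) mu
     in of_blocks (\<lambda>k. case k of
          Pi1 \<Rightarrow> blk z Pi1 \<times> \<Omega>1
        | Pi2 \<Rightarrow> blk z Pi2 \<times> \<Omega>2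
        | Pi0 \<Rightarrow> (blk z Pi0 \<times> \<Omega>0) + (lam \<times> dlam) + (mu \<times> dmu)
        | Lam \<Rightarrow> (1 / g1) *\<^sub>R plam + (lam \<times> \<Omega>0)
        | PLam \<Rightarrow> (plam \<times> \<Omega>0) - dlam
        | Mu \<Rightarrow> (1 / g2) *\<^sub>R pmu + (mu \<times> \<Omega>0)
        | PMu \<Rightarrow> (pmu \<times> \<Omega>0) - dmu))"

definition relative_equilibrium :: "(state \<Rightarrow> state) \<Rightarrow> state \<Rightarrow> bool" where
  "relative_equilibrium f z \<longleftrightarrow> f z = 0"

definition lagrangian :: "real \<Rightarrow> real \<Rightarrow> real \<Rightarrow> state \<Rightarrow> bool" where
  "lagrangian A0 C0 l z \<longleftrightarrow>
     \<not> collinear {0, blk z Lam, blk z Mu}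
     \<and> orthogonal (Omega_gyro A0 C0 l (blk z Pi0)) (blk z Lam)
     \<and> orthogonal (Omega_gyro A0 C0 l (blk z Pi0)) (blk z Mu)"

definition eigenvalue :: "complex ^ 'n ^ 'n \<Rightarrow> complex \<Rightarrow> bool" where
  "eigenvalue M c \<longleftrightarrow> (\<exists>v. v \<noteq> 0 \<and> M *v v = c *s v)"

definition jacobian :: "(real ^ 'n \<Rightarrow> real ^ 'n) \<Rightarrow> real ^ 'n \<Rightarrow> real ^ 'n ^ 'n" where
  "jacobian f z = matrix (frechet_derivative f (at z))"

definition spectrally_stable :: "(real ^ 'n \<Rightarrow> real ^ 'n) \<Rightarrow> real ^ 'n \<Rightarrow> bool" where
  "spectrally_stable f z \<longleftrightarrow>
     (\<forall>c. eigenvalue (map_matrix complex_of_real (jacobian f z)) c \<longrightarrow> Re c = 0)"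

definition forward_solution ::
  "(real ^ 'n \<Rightarrow> real ^ 'n) \<Rightarrow> (real \<Rightarrow> real ^ 'n) \<Rightarrow> bool" where
  "forward_solution f x \<longleftrightarrow>
     (\<forall>t\<ge>0. (x has_vector_derivative f (x t)) (at t within {0..}))"

text \<open>Stability in the sense of Lyapunov: the solution starting near \<open>z\<close> is defined for all
  \<open>t \<ge> 0\<close> and remains near \<open>z\<close>. For a vector field that is locally Lipschitz near \<open>z\<close>
  (such as the one above, away from collisions) the solution is unique, and it is defined
  for all \<open>t \<ge> 0\<close> as soon as it cannot leave a small closed ball; hence a failure of
  stability means that solutions starting arbitrarily near \<open>z\<close> leave a fixed
  neighbourhood.\<close>

definition lyapunov_stable :: "(real ^ 'n \<Rightarrow> real ^ 'n) \<Rightarrow> real ^ 'n \<Rightarrow> bool" where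
  "lyapunov_stable f z \<longleftrightarrow>
     (\<forall>\<epsilon>>0. \<exists>\<delta>>0. \<forall>w. dist w z < \<delta> \<longrightarrow>
        (\<exists>x. x 0 = w \<and> forward_solution f x \<and> (\<forall>t\<ge>0. dist (x t) z < \<epsilon>)))"

definition unstable :: "(real ^ 'n \<Rightarrow> real ^ 'n) \<Rightarrow> real ^ 'n \<Rightarrow> bool" where
  "unstable f z \<longleftrightarrow> \<not> lyapunov_stable f z"

text \<open>The explicit equilateral configuration is a Lagrangian relative equilibrium, so that
  assuming this along with the explicit formulas is consistent.\<close>

lemma matrix_inv_inertia:
  assumes "A \<noteq> 0" "C \<noteq> 0"
  shows "matrix_inv (inertia A C) *v P = vector [P $ 1 / A, P $ 2 / A, P $ 3 / C]"
proof -
  let ?M = "inertia A C"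
  let ?w = "vector [P $ 1 / A, P $ 2 / A, P $ 3 / C] :: real ^ 3"
  let ?N = "inertia (1 / A) (1 / C)"
  have 1: "?M ** ?N = mat 1" "?N ** ?M = mat 1"
    using assms by (auto simp: inertia_def matrix_matrix_mult_def mat_def vec_eq_iff forall_3 sum_3)
  then have 2: "matrix_inv ?M ** ?M = mat 1"
    unfolding matrix_inv_def by (metis (mono_tags, lifting) someI_ex)
  have "matrix_inv ?M = matrix_inv ?M ** (?M ** ?N)" by (simp add: 1)
  also have "\<dots> = ?N" by (simp add: matrix_mul_assoc 2)
  finally have "matrix_inv ?M = ?N" .
  then show ?thesis
    by (simp add: inertia_def matrix_vector_mult_def vec_eq_iff forall_3 sum_3)
qed

lemma grad_eqI: "GDERIV f x :> D \<Longrightarrow> grad f x = D"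
  unfolding grad_def
proof (rule the_equality)
  fix D' assume "GDERIV f x :> D" "GDERIV f x :> D'"
  then have "(\<lambda>h. inner h D) = (\<lambda>h. inner h D')"
    unfolding gderiv_def by (rule has_derivative_unique)
  then show "D' = D" by (metis vector_eq_ldot)
qed

lemma GDERIV_inverse_norm:
  fixes a x :: "real ^ 3"
  assumes "a + c *\<^sub>R x \<noteq> 0"
  shows "GDERIV (\<lambda>u. k / norm (a + c *\<^sub>R u)) x :>
           (- (k * c / norm (a + c *\<^sub>R x) ^ 3)) *\<^sub>R (a + c *\<^sub>R x)"
proof -
  have "((\<lambda>u. norm (a + c *\<^sub>R u)) has_derivative (\<lambda>h. inner (sgn (a + c *\<^sub>R x)) (c *\<^sub>R h))) (at x)"
  proof -
    have 1: "((\<lambda>u. a + c *\<^sub>R u) has_derivative (\<lambda>h. c *\<^sub>R h)) (at x)"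
      by (auto intro!: derivative_eq_intros)
    have 2: "(norm has_derivative (\<lambda>h. inner h (sgn (a + c *\<^sub>R x)))) (at (a + c *\<^sub>R x))"
      using GDERIV_norm[OF assms] unfolding gderiv_def .
    show ?thesis using has_derivative_compose[OF 1 2] by (simp add: inner_commute)
  qed
  then have "((\<lambda>u. k / norm (a + c *\<^sub>R u)) has_derivative
     (\<lambda>h. - k * (inverse (norm (a + c *\<^sub>R x)) * inner (sgn (a + c *\<^sub>R x)) (c *\<^sub>R h) * inverse (norm (a + c *\<^sub>R x))))) (at x)"
    unfolding divide_inverse using assms
    by (auto intro!: derivative_eq_intros)
  moreover have "(\<lambda>h. - k * (inverse (norm (a + c *\<^sub>R x)) * inner (sgn (a + c *\<^sub>R x)) (c *\<^sub>R h) * inverse (norm (a + c *\<^sub>R x))))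
    = (\<lambda>h. inner h ((- (k * c / norm (a + c *\<^sub>R x) ^ 3)) *\<^sub>R (a + c *\<^sub>R x)))"
    unfolding sgn_div_norm inner_scaleR_left inner_scaleR_right
    using assms by (simp add: fun_eq_iff inner_commute[of "a + c *\<^sub>R x"] divide_inverse power3_eq_cube)
  ultimately show ?thesis unfolding gderiv_def by simp
qed

lemma grad_potential_lam:
  assumes "lam \<noteq> 0" "mu - (m2 / (m1 + m2)) *\<^sub>R lam \<noteq> 0" "mu + (m1 / (m1 + m2)) *\<^sub>R lam \<noteq> 0"
  shows "grad (\<lambda>u. potential G m0 m1 m2 u mu) lam =
    (G * m1 * m2 / norm lam ^ 3) *\<^sub>R lam
    - (G * m1 * m0 * (m2 / (m1 + m2)) / norm (mu - (m2 / (m1 + m2)) *\<^sub>R lam) ^ 3) *\<^sub>R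
         (mu - (m2 / (m1 + m2)) *\<^sub>R lam)
    + (G * m2 * m0 * (m1 / (m1 + m2)) / norm (mu + (m1 / (m1 + m2)) *\<^sub>R lam) ^ 3) *\<^sub>R
         (mu + (m1 / (m1 + m2)) *\<^sub>R lam)"
proof (rule grad_eqI)
  note 1 = GDERIV_inverse_norm[of 0 1 lam "G * m1 * m2", simplified, OF assms(1)]
  note 2 = GDERIV_inverse_norm[of mu "- (m2 / (m1 + m2))" lam "G * m1 * m0",
      unfolded scaleR_minus_left add_uminus_conv_diff, OF assms(2)]
  note 3 = GDERIV_inverse_norm[of mu "m1 / (m1 + m2)" lam "G * m2 * m0", OF assms(3)]
  show "GDERIV (\<lambda>u. potential G m0 m1 m2 u mu) lam :>
    (G * m1 * m2 / norm lam ^ 3) *\<^sub>R lam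
    - (G * m1 * m0 * (m2 / (m1 + m2)) / norm (mu - (m2 / (m1 + m2)) *\<^sub>R lam) ^ 3) *\<^sub>R
         (mu - (m2 / (m1 + m2)) *\<^sub>R lam)
    + (G * m2 * m0 * (m1 / (m1 + m2)) / norm (mu + (m1 / (m1 + m2)) *\<^sub>R lam) ^ 3) *\<^sub>R
         (mu + (m1 / (m1 + m2)) *\<^sub>R lam)"
    unfolding potential_def
    by (rule GDERIV_subst[OF GDERIV_minus[OF GDERIV_add[OF GDERIV_add[OF 1 2] 3]]]) simp
qed

lemma grad_potential_mu:
  assumes "mu - (m2 / (m1 + m2)) *\<^sub>R lam \<noteq> 0" "mu + (m1 / (m1 + m2)) *\<^sub>R lam \<noteq> 0"
  shows "grad (\<lambda>u. potential G m0 m1 m2 lam u) mu =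
    (G * m1 * m0 / norm (mu - (m2 / (m1 + m2)) *\<^sub>R lam) ^ 3) *\<^sub>R (mu - (m2 / (m1 + m2)) *\<^sub>R lam)
    + (G * m2 * m0 / norm (mu + (m1 / (m1 + m2)) *\<^sub>R lam) ^ 3) *\<^sub>R (mu + (m1 / (m1 + m2)) *\<^sub>R lam)"
proof (rule grad_eqI)
  have 1: "GDERIV (\<lambda>u::real^3. G * m1 * m2 / norm lam) mu :> 0" by (rule GDERIV_const)
  note 2 = GDERIV_inverse_norm[of "- ((m2 / (m1 + m2)) *\<^sub>R lam)" 1 mu "G * m1 * m0",
      simplified add.commute[of "- _"] scaleR_one add_uminus_conv_diff mult_1_right, OF assms(1)]
  note 3 = GDERIV_inverse_norm[of "(m1 / (m1 + m2)) *\<^sub>R lam" 1 mu "G * m2 * m0",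
      simplified add.commute[of "_ *\<^sub>R lam"] scaleR_one mult_1_right, OF assms(2)]
  show "GDERIV (\<lambda>u. potential G m0 m1 m2 lam u) mu :>
    (G * m1 * m0 / norm (mu - (m2 / (m1 + m2)) *\<^sub>R lam) ^ 3) *\<^sub>R (mu - (m2 / (m1 + m2)) *\<^sub>R lam)
    + (G * m2 * m0 / norm (mu + (m1 / (m1 + m2)) *\<^sub>R lam) ^ 3) *\<^sub>R (mu + (m1 / (m1 + m2)) *\<^sub>R lam)"
    unfolding potential_def
    by (rule GDERIV_subst[OF GDERIV_minus[OF GDERIV_add[OF GDERIV_add[OF 1 2] 3]]]) simp
qed

lemma equilateral_is_lagrangian_relative_equilibrium:
  fixes ze :: state
  assumes pos: "G > 0" "m0 > 0" "m1 > 0" "m2 > 0" "A0 > 0" "C0 > 0" "A1 > 0" "A2 > 0" "Z > 0"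
    and x2: "x2 = Z * (m2 - m1) / (2 * (m1 + m2))"
    and y2: "y2 = sqrt 3 * Z / 2 \<or> y2 = - (sqrt 3 * Z / 2)"
    and w: "\<omega>0\<^sup>2 = G * (m0 + m1 + m2) / Z ^ 3"
    and Lam: "blk ze Lam = vector [Z, 0, 0]"
    and PLam: "blk ze PLam = (m1 * m2 / (m1 + m2) * \<omega>0) *\<^sub>R vector [0, Z, 0]"
    and Mu: "blk ze Mu = vector [x2, y2, 0]"
    and PMu: "blk ze PMu = (m0 * (m1 + m2) / (m0 + m1 + m2) * \<omega>0) *\<^sub>R vector [- y2, x2, 0]"
    and Pi0: "blk ze Pi0 = vector [0, 0, C0 * \<omega>0 + l]"
  shows "Omega_gyro A0 C0 l (blk ze Pi0) = vector [0, 0, \<omega>0]"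
    and "relative_equilibrium (eq_motion G m0 m1 m2 A0 C0 A1 A1 A2 A2 l) ze"
    and "lagrangian A0 C0 l ze"
proof -
  let ?l = "vector [Z, 0, 0] :: real ^ 3" and ?m = "vector [x2, y2, 0] :: real ^ 3"
  let ?d1 = "?m - (m2 / (m1 + m2)) *\<^sub>R ?l" and ?d2 = "?m + (m1 / (m1 + m2)) *\<^sub>R ?l"
  have M: "m1 + m2 > 0" "m0 + m1 + m2 > 0" using pos by auto
  have yy: "y2 * y2 = 3 / 4 * Z\<^sup>2" proof -
    have "y2\<^sup>2 = 3 / 4 * Z\<^sup>2" 
    proof -
      have "y2\<^sup>2 = (sqrt 3 * Z / 2)\<^sup>2" using y2 by (metis power2_minus)
      then show ?thesis by (simp add: power_mult_distrib power_divide)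
    qed
    then show ?thesis by (simp add: power2_eq_square)
  qed
  have y0: "y2 \<noteq> 0" using yy pos by auto
  show Om: "Omega_gyro A0 C0 l (blk ze Pi0) = vector [0, 0, \<omega>0]"
    using pos by (simp add: Omega_gyro_def matrix_inv_inertia Pi0 gyr_momentum_def vec_eq_iff forall_3)
  show "lagrangian A0 C0 l ze"
    unfolding lagrangian_def Om Lam Mu collinear_lemma
    using pos y0 by (auto simp: orthogonal_def inner_vec_def sum_3 vec_eq_iff forall_3)
  have e1: "x2 - m2 / (m1 + m2) * Z = - Z / 2" and e2: "x2 + m1 / (m1 + m2) * Z = Z / 2"
    using M by (simp_all add: x2 divide_simps) (simp_all add: algebra_simps)
  have d1: "?d1 = vector [- Z / 2, y2, 0]"
    using e1 by (simp add: vec_eq_iff forall_3)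
  have d2: "?d2 = vector [Z / 2, y2, 0]"
    using e2 by (simp add: vec_eq_iff forall_3)
  have n: "norm ?l = Z" "norm ?d1 = Z" "norm ?d2 = Z"
    unfolding d1 d2 norm_eq_sqrt_inner inner_vec_def sum_3 using pos yy
    by (auto simp: real_sqrt_mult power2_eq_square intro!: real_sqrt_unique)
  have nz: "?l \<noteq> 0" "?d1 \<noteq> 0" "?d2 \<noteq> 0" using n pos by (metis norm_zero less_irrefl)+
  have w': "G = \<omega>0\<^sup>2 * Z ^ 3 / (m0 + m1 + m2)" using w M pos by (simp add: field_simps)
  have gl: "grad (\<lambda>u. potential G m0 m1 m2 u ?m) ?l = (m1 * m2 / (m1 + m2) * \<omega>0\<^sup>2) *\<^sub>R ?l"
  proof -
    have "m1 * m2 / S * \<omega>0\<^sup>2 * Z =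
        \<omega>0\<^sup>2 * Z ^ 3 / (m0 + S) * m1 * m2 / Z ^ 3 * Z
        - \<omega>0\<^sup>2 * Z ^ 3 / (m0 + S) * m1 * m0 * (m2 / S) / Z ^ 3 * (- Z / 2)
        + \<omega>0\<^sup>2 * Z ^ 3 / (m0 + S) * m2 * m0 * (m1 / S) / Z ^ 3 * (Z / 2)"
      if "S > 0" "m0 + S > 0" for S
      using that pos by (simp add: divide_simps) (simp add: algebra_simps)
    from this[of "m1 + m2"] show ?thesis
      unfolding grad_potential_lam[OF nz] n unfolding d1 d2 w'
      unfolding vec_eq_iff forall_3 vector_add_component vector_minus_component
        vector_scaleR_component vector_3 real_scaleR_def
      using M by (simp add: add.assoc)
  qed
  have gm: "grad (\<lambda>u. potential G m0 m1 m2 ?l u) ?m = (m0 * (m1 + m2) / (m0 + m1 + m2) * \<omega>0\<^sup>2) *\<^sub>R ?m"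
  proof -
    have "x2 * (m1 + m2) = Z * (m2 - m1) / 2" using M by (simp add: x2 divide_simps)
    then have x2': "m0 * (m1 + m2) / (m0 + m1 + m2) * \<omega>0\<^sup>2 * x2 =
        m0 / (m0 + m1 + m2) * \<omega>0\<^sup>2 * (Z * (m2 - m1) / 2)"
      by (metis mult.assoc mult.commute times_divide_eq_left)
    have "m0 * (m1 + m2) / (m0 + m1 + m2) * \<omega>0\<^sup>2 * x2 =
       \<omega>0\<^sup>2 * Z ^ 3 / (m0 + m1 + m2) * m1 * m0 / Z ^ 3 * (- Z / 2) +
       \<omega>0\<^sup>2 * Z ^ 3 / (m0 + m1 + m2) * m2 * m0 / Z ^ 3 * (Z / 2)"
      unfolding x2' using M pos by (simp add: divide_simps) (simp add: algebra_simps)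
    moreover have "m0 * (m1 + m2) / (m0 + m1 + m2) * \<omega>0\<^sup>2 * y2 =
       \<omega>0\<^sup>2 * Z ^ 3 / (m0 + m1 + m2) * m1 * m0 / Z ^ 3 * y2 +
       \<omega>0\<^sup>2 * Z ^ 3 / (m0 + m1 + m2) * m2 * m0 / Z ^ 3 * y2"
      using M pos by (simp add: divide_simps) (simp add: algebra_simps)
    ultimately show ?thesis
      unfolding grad_potential_mu[OF nz(2,3)] n unfolding d1 d2 w'
      unfolding vec_eq_iff forall_3 vector_add_component vector_scaleR_component vector_3 real_scaleR_def
      by simp
  qed
  have s: "blk ze Pi1 \<times> Omega_rigid A1 A1 (blk ze Pi1) = 0" "blk ze Pi2 \<times> Omega_rigid A2 A2 (blk ze Pi2) = 0"
    using pos by (auto simp: Omega_rigid_def matrix_inv_inertia cross3_def vec_eq_iff forall_3)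
  show "relative_equilibrium (eq_motion G m0 m1 m2 A0 C0 A1 A1 A2 A2 l) ze"
    unfolding relative_equilibrium_def eq_motion_def Let_def of_blocks_def Om s
    unfolding Lam Mu PLam PMu Pi0 gl gm
    using M pos
    by (auto simp: vec_eq_iff forall_3 cross3_def power2_eq_square split: block.split)
qed

end

theory Submission
  imports Defs "HOL-Computational_Algebra.Fundamental_Theorem_Algebra"
begin

text \<open>Where the bodies do not collide, the torque on the gyrostat vanishes (the potential is rotation
invariant) and the two spheres keep their momenta. What remains is the problem of three point masses,
seen from a frame turning with the gyrostat. At the equilibrium this frame turns uniformly, and the
linearized equations split.

The momenta of the rigid bodies contribute eigenvalues on the imaginary axis, and so do displacements
orthogonal to the plane of the triangle, which oscillate with frequency \<open>\<omega>\<close>. In the plane, the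
displacement of the side \<open>s\<^sub>j\<close> is written as \<open>s\<^sub>j (a + b \<rho>\<^sup>j)\<close>, where \<open>\<rho>\<close> is the primitive cube
root of unity that turns one side into the next. This accounts for every displacement, because the
three sides always add up to zero. The complex number \<open>a\<close> scales and turns the triangle without
changing its shape, and \<open>b\<close> changes the shape. The equations for \<open>b\<close> and its conjugate do not
contain \<open>a\<close>: this is \<open>act_mode\<close>, where \<open>mode\<close> is a multiple of \<open>b\<close>. They lead to
\<open>c\<^sup>4 + \<omega>\<^sup>2 c\<^sup>2 + (27/4) \<kappa>\<^sup>2 (m\<^sub>0 m\<^sub>1 + m\<^sub>0 m\<^sub>2 + m\<^sub>1 m\<^sub>2) = 0\<close> with \<open>\<omega>\<^sup>2 = \<kappa> (m\<^sub>0 + m\<^sub>1 + m\<^sub>2)\<close>; if \<open>b = 0\<close>, then \<open>a\<close>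
obeys the linearized Kepler problem, whose eigenvalues are \<open>0\<close> and \<open>\<plusminus> \<i> \<omega>\<close>. So an eigenvalue off
the imaginary axis is a root of the quartic (\<open>eigenvalue_dichotomy\<close>).

Conversely each root of the quartic is an eigenvalue (\<open>mode_root_imp_eigenvalue\<close>), since the system for
\<open>b\<close> yields a left eigenvector. As a quadratic in \<open>c\<^sup>2\<close> the quartic has discriminant
\<open>\<kappa>\<^sup>2 ((m\<^sub>0 + m\<^sub>1 + m\<^sub>2)\<^sup>2 - 27 (m\<^sub>0 m\<^sub>1 + m\<^sub>0 m\<^sub>2 + m\<^sub>1 m\<^sub>2))\<close>. If this is nonnegative, both values of \<open>c\<^sup>2\<close>
are negative and \<open>c\<close> is imaginary; if it is negative, \<open>c\<^sup>2\<close> is not real and one of its square roots has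
positive real part.

Instability of the nonlinear system then follows from \<open>unstable_if_eigenvalue_Re_pos\<close>. Its proof solves a
Lyapunov equation for a quadratic form that takes positive values somewhere and that, along solutions
near the equilibrium, grows at least exponentially wherever it is positive.\<close>

section \<open>Polynomials of a complex matrix\<close>

definition poly_act :: "complex ^ 'n ^ 'n \<Rightarrow> complex poly \<Rightarrow> complex ^ 'n \<Rightarrow> complex ^ 'n" where
  "poly_act M p = fold_coeffs (\<lambda>a f x. a *s x + M *v f x) p (\<lambda>x. 0)"

lemma poly_act_0 [simp]: "poly_act M 0 x = 0"
  by (simp add: poly_act_def)

lemma poly_act_pCons [simp]: "poly_act M (pCons a p) x = a *s x + M *v poly_act M p x"
  by (cases "p = 0 \<and> a = 0") (auto simp: poly_act_def)

lemma poly_act_add: "poly_act M (p + q) x = poly_act M p x + poly_act M q x"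
proof (induction p arbitrary: q)
  case (pCons a p)
  then show ?case
    by (cases q) (simp add: vec.add matrix_vector_right_distrib algebra_simps)
qed simp

lemma poly_act_smult: "poly_act M (smult c p) x = c *s poly_act M p x"
  by (induction p) (simp_all add: vector_add_ldistrib vector_smult_assoc vec.scale)

lemma poly_act_mult: "poly_act M (p * q) x = poly_act M p (poly_act M q x)"
  by (induction p) (simp_all add: poly_act_add poly_act_smult)

lemma poly_act_eigenvector: "M *v x = c *s x \<Longrightarrow> poly_act M p x = poly p c *s x"
  by (induction p) (simp_all add: vec.scale vector_smult_assoc algebra_simps vector_sadd_rdistrib mult.commute)

text \<open>Linear factors of \<open>p(M)\<close> are applied to \<open>y\<close> one after the other; the last nonzero vector before
the result becomes zero is an eigenvector.\<close>
lemma poly_act_zero_imp_eigenvector: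
  assumes "p \<noteq> 0" "y \<noteq> 0" "poly_act M p y = 0"
  shows "\<exists>r w. poly p r = 0 \<and> w \<noteq> 0 \<and> M *v w = r *s w"
  using assms
proof (induction "degree p" arbitrary: p y)
  case 0
  then obtain a where "p = [:a:]" by (metis degree_eq_zeroE)
  with 0 have False by (simp add: vec.scale_eq_0_iff)
  then show ?case ..
next
  case (Suc n)
  then have "\<not> constant (poly p)" by (simp add: constant_degree)
  then obtain r where r: "poly p r = 0" using fundamental_theorem_of_algebra by blast
  then obtain q where q: "p = [:- r, 1:] * q" by (metis dvd_def poly_eq_0_iff_dvd)
  have q0: "q \<noteq> 0" using Suc.prems q by auto
  then have dq: "degree q = n" using Suc.hyps(2) unfolding q by (subst (asm) degree_mult_eq) auto
  let ?y = "poly_act M [:- r, 1:] y"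
  show ?case
  proof (cases "?y = 0")
    case True
    then show ?thesis using r Suc.prems(2)
      by (intro exI[of _ r] exI[of _ y]) (simp add: vec.scale add.commute neg_eq_iff_add_eq_0)
  next
    case False
    have "poly_act M q ?y = poly_act M p y"
      unfolding q poly_act_mult[symmetric] by (simp only: mult.commute)
    with False Suc.prems(3) show ?thesis
      using Suc.hyps(1)[OF dq[symmetric] q0 False] unfolding q by auto
  qed
qed

lemma linear_dependence_sequence:
  fixes f :: "nat \<Rightarrow> 'a :: euclidean_space"
  shows "\<exists>c. (\<exists>k\<le>DIM('a). c k \<noteq> 0) \<and> (\<Sum>k\<le>DIM('a). c k *\<^sub>R f k) = 0"
proof (cases "inj_on f {..DIM('a)}")
  case True
  then have "card (f ` {..DIM('a)}) > DIM('a)" by (simp add: card_image)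
  then have "dependent (f ` {..DIM('a)})" by (simp add: dependent_biggerset)
  then obtain u where u: "\<exists>v\<in>f ` {..DIM('a)}. u v \<noteq> 0" "(\<Sum>v\<in>f ` {..DIM('a)}. u v *\<^sub>R v) = 0"
    by (auto simp: dependent_finite)
  have "(\<Sum>k\<le>DIM('a). u (f k) *\<^sub>R f k) = 0" using u(2) by (simp add: sum.reindex[OF True])
  with u(1) show ?thesis by (intro exI[of _ "\<lambda>k. u (f k)"]) auto
next
  case False
  then obtain i j where ij: "i \<le> DIM('a)" "j \<le> DIM('a)" "i \<noteq> j" "f i = f j"
    by (auto simp: inj_on_def)
  define c :: "nat \<Rightarrow> real" where "c k = (if k = i then 1 else if k = j then - 1 else 0)" for k
  have "(\<Sum>k\<le>DIM('a). c k *\<^sub>R f k) = (\<Sum>k\<in>{i, j}. c k *\<^sub>R f k)"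
    using ij by (intro sum.mono_neutral_right) (auto simp: c_def)
  also have "\<dots> = 0" using ij by (simp add: c_def)
  finally show ?thesis using ij by (intro exI[of _ c]) (auto simp: c_def)
qed

text \<open>The powers of \<open>M\<close> lie in a finite-dimensional space, hence satisfy a linear relation. Every eigenvalue
of \<open>M\<close> is a root of the resulting polynomial, so this also bounds the spectrum by a finite set.\<close>
lemma annihilating_polynomial:
  fixes M :: "complex ^ 'n ^ 'n"
  obtains p where "p \<noteq> 0" "\<And>x. poly_act M p x = 0"
proof -
  let ?pow = "\<lambda>k. (((**) M) ^^ k) (mat 1)" and ?n = "DIM(complex ^ 'n ^ 'n)"
  obtain c where c: "\<exists>k\<le>?n. c k \<noteq> 0" "(\<Sum>k\<le>?n. c k *\<^sub>R ?pow k) = 0"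
    using linear_dependence_sequence[of ?pow] by auto
  let ?p = "\<Sum>k\<le>?n. monom (complex_of_real (c k)) k"
  have monom: "poly_act M (monom (of_real a) k) x = (a *\<^sub>R ?pow k) *v x" for a k x
  proof (induction k)
    case 0
    have "(a *\<^sub>R mat 1) *v x = of_real a *s x"
    proof -
      have "(a *\<^sub>R mat 1) *v x = a *\<^sub>R (mat 1 *v x)"
        by (simp only: vec_eq_iff matrix_vector_mult_def vec_lambda_beta vector_scaleR_component
            scaleR_sum_right mult_scaleR_left simp_thms)
      then show ?thesis by (simp add: vec_eq_iff scaleR_conv_of_real[where 'a=complex])
    qed
    then show ?case by (simp add: monom_0)
  next
    case (Suc k)
    have "M ** (a *\<^sub>R ?pow k) = a *\<^sub>R (M ** ?pow k)"
      by (simp only: vec_eq_iff matrix_matrix_mult_def vec_lambda_beta vector_scaleR_component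
          scaleR_sum_right mult_scaleR_right simp_thms)
    then have "M *v ((a *\<^sub>R ?pow k) *v x) = (a *\<^sub>R ?pow (Suc k)) *v x"
      by (simp add: matrix_vector_mul_assoc)
    with Suc show ?case by (simp add: monom_Suc)
  qed
  have "poly_act M (\<Sum>k\<in>K. monom (of_real (c k)) k) x = (\<Sum>k\<in>K. c k *\<^sub>R ?pow k) *v x" if "finite K" for K x
    using that by induction (simp_all add: poly_act_add monom matrix_vector_mult_add_rdistrib)
  from this[of "{..?n}"] have "poly_act M ?p x = 0" for x unfolding c(2) by simp
  moreover have "?p \<noteq> 0"
  proof
    assume "?p = 0"
    obtain k where k: "k \<le> ?n" "c k \<noteq> 0" using c by auto
    have "coeff ?p k = of_real (c k)" using k by (simp add: coeff_sum)
    with \<open>?p = 0\<close> k show False by simp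
  qed
  ultimately show ?thesis using that by blast
qed

text \<open>The form in which eigenvalues are detected below: a left eigenvector gives a linear functional that
vanishes on the range of \<open>M - c\<close>, so this range omits every \<open>y\<close> where the functional is nonzero.\<close>
lemma not_surj_imp_eigenvalue:
  fixes M :: "complex ^ 'n ^ 'n"
  assumes "\<And>v. M *v v - c *s v \<noteq> y"
  shows "eigenvalue M c"
proof (rule ccontr)
  let ?N = "M - mat c"
  have N: "?N *v v = M *v v - c *s v" for v
    by (simp add: matrix_vector_mult_diff_rdistrib)
      (simp add: vec_eq_iff matrix_vector_mult_def mat_def if_distrib if_distribR cong: if_cong)
  assume "\<not> eigenvalue M c"
  then have "\<forall>v. ?N *v v = 0 \<longrightarrow> v = 0" by (auto simp: eigenvalue_def N)
  then have "inj ((*v) ?N)" by (simp add: vec.inj_iff_eq_0)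
  then have "surj ((*v) ?N)"
    by (metis matrix_left_invertible_injective matrix_left_right_inverse matrix_right_invertible_surjective)
  then obtain v where "?N *v v = y" by (metis surjE)
  with assms N show False by metis
qed

lemma eigenvalue_transpose:
  fixes M :: "complex ^ 'n ^ 'n"
  assumes "eigenvalue (transpose M) c"
  shows "eigenvalue M c"
proof -
  obtain w where w: "w \<noteq> 0" "transpose M *v w = c *s w" using assms by (auto simp: eigenvalue_def)
  then obtain i where i: "w $ i \<noteq> 0" by (auto simp: vec_eq_iff)
  let ?dot = "\<lambda>y. \<Sum>j\<in>UNIV. w $ j * y $ j"
  have "?dot (M *v v) = c * ?dot v" for v
  proof -
    have "?dot (M *v v) = (\<Sum>k\<in>UNIV. (transpose M *v w) $ k * v $ k)"
      unfolding matrix_vector_mult_def transpose_def vec_lambda_beta sum_distrib_left sum_distrib_right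
      by (subst sum.swap) (simp add: mult_ac)
    also have "\<dots> = c * ?dot v" using w(2) by (simp add: sum_distrib_left mult_ac)
    finally show ?thesis .
  qed
  then have "?dot (M *v v - c *s v) = 0" for v
    by (simp add: right_diff_distrib sum_subtractf sum_distrib_left mult_ac)
  moreover have "?dot (axis i 1) \<noteq> 0" using i by (simp add: axis_def if_distrib cong: if_cong)
  ultimately show ?thesis by (intro not_surj_imp_eigenvalue[of _ _ "axis i 1"]) metis
qed

section \<open>Lyapunov instability from an unstable eigenvalue\<close>

lemma poly_act_intertwine:
  assumes "\<And>u. X *v (M *v u) = N *v (X *v u)"
  shows "poly_act N q (X *v u) = X *v poly_act M q u"
  by (induction q) (simp_all add: assms vec.add vec.scale matrix_vector_right_distrib)

lemma map_matrix_mult_eq: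
  "map_matrix complex_of_real (A ** B) = map_matrix complex_of_real A ** map_matrix complex_of_real B"
  by (simp add: vec_eq_iff matrix_matrix_mult_def)

lemma sum_mat: "(\<Sum>k\<in>UNIV. mat c $ i $ k * f k) = c * f i" for c :: "'a::comm_ring_1"
  by (simp add: mat_def if_distrib[of "\<lambda>x. x * _"] cong: if_cong)

text \<open>The left side is a linear operator in \<open>X\<close>, so it suffices that its kernel is zero. For \<open>X\<close> in the
kernel, \<open>X A = N X\<close> with \<open>N = t - A\<^sup>T\<close>, hence \<open>p(N) X = X p(A) = 0\<close>. If \<open>X \<noteq> 0\<close>, some root \<open>r\<close> of \<open>p\<close>
is therefore an eigenvalue of \<open>N\<close>, and then \<open>t - r\<close> is an eigenvalue of \<open>A\<close>, thus again a root of
\<open>p\<close>. The two roots add up to \<open>t\<close>, which is excluded.\<close>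
lemma lyapunov_equation_solvable:
  fixes A :: "real ^ 'n ^ 'n" and t :: real and p :: "complex poly"
  defines "AC \<equiv> map_matrix complex_of_real A"
  assumes p: "\<And>x. poly_act AC p x = 0" "p \<noteq> 0"
    and t: "\<And>r s. poly p r = 0 \<Longrightarrow> poly p s = 0 \<Longrightarrow> r + s \<noteq> of_real t"
  shows "\<exists>X. transpose A ** X + X ** A - t *\<^sub>R X = B"
proof -
  let ?L = "\<lambda>X. transpose A ** X + X ** A - t *\<^sub>R X"
  have scal: "A ** (a *\<^sub>R X) = a *\<^sub>R (A ** X)" "(a *\<^sub>R X) ** A = a *\<^sub>R (X ** A)"
    for a and A X :: "real ^ 'n ^ 'n"
    by (simp_all add: vec_eq_iff matrix_matrix_mult_def sum_distrib_left mult_ac)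
  have add_rdist: "(X + Y) ** A = X ** A + Y ** A" for X Y :: "real ^ 'n ^ 'n"
    by (simp add: vec_eq_iff matrix_matrix_mult_def distrib_right sum.distrib)
  have lin: "linear ?L"
    by (rule linearI) (simp_all add: matrix_add_ldistrib add_rdist scal algebra_simps)
  have ker: "X = 0" if X: "?L X = 0" for X
  proof (rule ccontr)
    assume "X \<noteq> 0"
    then obtain i j where ij: "X $ i $ j \<noteq> 0" by (auto simp: vec_eq_iff)
    let ?X = "map_matrix complex_of_real X"
    let ?N = "mat (of_real t) - transpose AC"
    have N: "?N *v v = of_real t *s v - transpose AC *v v" for v
      by (simp add: matrix_vector_mult_diff_rdistrib)
        (simp add: vec_eq_iff matrix_vector_mult_def mat_def if_distrib if_distribR cong: if_cong)
    have "X ** A = t *\<^sub>R X - transpose A ** X" using X by (simp add: algebra_simps)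
    then have "?X ** AC = map_matrix complex_of_real (t *\<^sub>R X - transpose A ** X)"
      by (simp only: AC_def map_matrix_mult_eq[symmetric])
    also have "\<dots> = ?N ** ?X"
      by (simp add: vec_eq_iff matrix_matrix_mult_def transpose_def AC_def
          left_diff_distrib sum_subtractf sum_mat)
    finally have "?X ** AC = ?N ** ?X" .
    then have "poly_act ?N p (?X *v u) = ?X *v poly_act AC p u" for u
      by (intro poly_act_intertwine) (simp add: matrix_vector_mul_assoc)
    then have "poly_act ?N p (?X *v axis j 1) = 0" by (simp add: p)
    moreover have "(?X *v axis j 1) $ i \<noteq> 0"
      using ij by (simp add: matrix_vector_mult_def axis_def if_distrib cong: if_cong)
    then have "?X *v axis j 1 \<noteq> 0" by (metis zero_index)
    ultimately obtain r w where r: "poly p r = 0" "w \<noteq> 0" "?N *v w = r *s w"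
      using poly_act_zero_imp_eigenvector[OF p(2)] by blast
    have "transpose AC *v w = (of_real t - r) *s w"
    proof -
      have "b = a - c" if "a - b = c" for a b c :: "complex ^ 'n" using that by auto
      from this[OF r(3)[unfolded N]] have "transpose AC *v w = of_real t *s w - r *s w" .
      then show ?thesis by (simp only: vector_sub_rdistrib)
    qed
    with r(2) have "eigenvalue (transpose AC) (of_real t - r)" unfolding eigenvalue_def by blast
    then have "eigenvalue AC (of_real t - r)" by (rule eigenvalue_transpose)
    then obtain v where v: "v \<noteq> 0" "AC *v v = (of_real t - r) *s v" by (auto simp: eigenvalue_def)
    have "poly p (of_real t - r) *s v = 0" using poly_act_eigenvector[OF v(2), of p] by (simp add: p)
    then have "poly p (of_real t - r) = 0" using v(1) by (simp add: vec.scale_eq_0_iff)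
    with t[OF r(1) this] show False by simp
  qed
  have "inj ?L" using lin ker by (simp add: linear_injective_0)
  then have "surj ?L" by (rule linear_injective_imp_surjective[OF lin _ refl])
  from surjD[OF this, of B] show ?thesis by (elim exE) (rule exI, erule sym)
qed

text \<open>Along \<open>x' = A x\<close> the form \<open>Q(x) = x \<bullet> X x\<close> satisfies \<open>Q' = t Q + x \<bullet> x\<close>. It is positive on the real or on the
imaginary part of the eigenvector for \<open>c\<close>, because that eigenvector itself grows faster, at rate
\<open>2 Re c > t\<close>. The choice of \<open>t\<close> has to avoid the finitely many sums of two
roots of an annihilating polynomial.\<close>
lemma growing_quadratic_form:
  fixes A :: "real ^ 'n ^ 'n"
  assumes ev: "eigenvalue (map_matrix complex_of_real A) c" and c: "Re c > 0"
  obtains X t x0 where "t > 0" "x0 \<bullet> (X *v x0) > 0"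
    "\<And>x. (A *v x) \<bullet> (X *v x) + x \<bullet> (X *v (A *v x)) = t * (x \<bullet> (X *v x)) + x \<bullet> x"
proof -
  let ?A = "map_matrix complex_of_real A"
  obtain p where p: "p \<noteq> 0" "\<And>x. poly_act ?A p x = 0" using annihilating_polynomial by blast
  let ?S = "(\<lambda>(r, s). Re (r + s)) ` ({r. poly p r = 0} \<times> {r. poly p r = 0})"
  have "finite ?S" using poly_roots_finite[OF p(1)] by blast
  moreover have "infinite {0<..<2 * Re c}" using c by (simp add: infinite_Ioo)
  ultimately obtain t where t: "t \<in> {0<..<2 * Re c}" "t \<notin> ?S"
    by (meson finite_subset subsetI)
  have "r + s \<noteq> of_real t" if "poly p r = 0" "poly p s = 0" for r s
  proof
    assume "r + s = of_real t"
    then have "t = Re (r + s)" by simp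
    then have "t \<in> ?S" using that by (intro image_eqI[of _ _ "(r, s)"]) auto
    with t(2) show False by contradiction
  qed
  then obtain X where X: "transpose A ** X + X ** A - t *\<^sub>R X = mat 1"
    using lyapunov_equation_solvable[OF p(2,1)] by blast
  have form: "(A *v x) \<bullet> (X *v x) + x \<bullet> (X *v (A *v x)) = t * (x \<bullet> (X *v x)) + x \<bullet> x" for x
  proof -
    have "(A *v x) \<bullet> (X *v x) = x \<bullet> (transpose A *v (X *v x))"
      by (metis dot_lmul_matrix inner_commute transpose_matrix_vector)
    then have "(A *v x) \<bullet> (X *v x) + x \<bullet> (X *v (A *v x)) - t * (x \<bullet> (X *v x))
      = x \<bullet> ((transpose A ** X + X ** A - t *\<^sub>R X) *v x)"
      by (simp add: matrix_vector_mult_add_rdistrib matrix_vector_mult_diff_rdistrib inner_add_right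
          inner_diff_right matrix_vector_mul_assoc scaleR_matrix_vector_assoc[symmetric])
    then show ?thesis by (simp add: X)
  qed
  obtain v where v: "v \<noteq> 0" "?A *v v = c *s v" using ev by (auto simp: eigenvalue_def)
  define a b where "a = (\<chi> i. Re (v $ i))" and "b = (\<chi> i. Im (v $ i))"
  have "Re ((?A *v v) $ i) = (A *v a) $ i" "Im ((?A *v v) $ i) = (A *v b) $ i" for i
    by (simp_all add: matrix_vector_mult_def a_def b_def)
  then have Aab: "A *v a = Re c *\<^sub>R a - Im c *\<^sub>R b" "A *v b = Re c *\<^sub>R b + Im c *\<^sub>R a"
    unfolding v(2) by (simp_all add: vec_eq_iff a_def b_def)
  have "(2 * Re c - t) * (a \<bullet> (X *v a) + b \<bullet> (X *v b)) = a \<bullet> a + b \<bullet> b"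
  proof -
    have combine: "(2 * r - t) * (p + q) = m + n"
      if "r * p - i * s + (r * p - i * u) = t * p + m" "r * q + i * u + (r * q + i * s) = t * q + n"
      for r i p q s u m n :: real
      using that by (simp add: algebra_simps)
    show ?thesis
      by (rule combine[of _ _ "Im c" "b \<bullet> (X *v a)" "a \<bullet> (X *v b)"])
        (use form[of a] form[of b] in \<open>simp_all only: Aab inner_add_left inner_add_right
          inner_diff_left inner_diff_right inner_scaleR_left inner_scaleR_right
          matrix_vector_mult_diff_distrib matrix_vector_right_distrib matrix_vector_mult_scaleR\<close>)
  qed
  moreover have "a \<bullet> a + b \<bullet> b > 0"
  proof -
    have "a \<noteq> 0 \<or> b \<noteq> 0" using v(1) by (auto simp: vec_eq_iff a_def b_def complex_eq_iff)
    then show ?thesis by (elim disjE) (simp_all add: add_pos_nonneg add_nonneg_pos)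
  qed
  moreover have "2 * Re c - t > 0" using t by simp
  ultimately have "a \<bullet> (X *v a) + b \<bullet> (X *v b) > 0" by (metis zero_less_mult_pos)
  then have "a \<bullet> (X *v a) > 0 \<or> b \<bullet> (X *v b) > 0" by linarith
  moreover have "t > 0" using t by simp
  ultimately show ?thesis using that[OF _ _ form] by (elim disjE) assumption+
qed

text \<open>Near \<open>z\<close> the term \<open>x \<bullet> x\<close> in the derivative of the form absorbs the error of the linearization, so
the form still grows exponentially along every solution that stays close to \<open>z\<close>. Started at a point
where it is positive, it would exceed the bound that holds on a small ball.\<close>
theorem unstable_if_eigenvalue_Re_pos:
  fixes f :: "real ^ 'n \<Rightarrow> real ^ 'n"
  assumes diff: "f differentiable (at z)" and f0: "f z = 0"
    and ev: "eigenvalue (map_matrix complex_of_real (jacobian f z)) c" and c: "Re c > 0"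
  shows "unstable f z"
  unfolding unstable_def
proof
  define A where "A = jacobian f z"
  have der: "(f has_derivative (\<lambda>h. A *v h)) (at z)"
  proof -
    have D: "(f has_derivative frechet_derivative f (at z)) (at z)"
      using diff by (simp only: frechet_derivative_works)
    have "(\<lambda>h. A *v h) = frechet_derivative f (at z)"
      unfolding A_def jacobian_def using has_derivative_linear[OF D]
      by (simp add: linear_matrix_vector_mul_eq matrix_works fun_eq_iff)
    with D show ?thesis by simp
  qed
  obtain X t x0 where t: "t > 0" and x0: "x0 \<bullet> (X *v x0) > 0"
    and form: "\<And>x. (A *v x) \<bullet> (X *v x) + x \<bullet> (X *v (A *v x)) = t * (x \<bullet> (X *v x)) + x \<bullet> x"
    by (rule growing_quadratic_form[OF ev[folded A_def] c]) (rule that, assumption+)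
  obtain K where K: "K > 0" "\<And>x. norm (X *v x) \<le> norm x * K"
    using bounded_linear.pos_bounded[OF matrix_vector_mul_bounded_linear[of X]] by blast
  (* With an error of at most norm y / (2 K) in the vector field, the two error terms in the
     derivative of the form add up to at most (norm y)^2. *)
  have "1 / (2 * K) > 0" using K(1) by simp
  with der obtain e where e: "e > 0" "\<And>y. norm (y - z) < e \<Longrightarrow>
      norm (f y - f z - A *v (y - z)) \<le> 1 / (2 * K) * norm (y - z)"
    unfolding has_derivative_at_alt by blast
  assume "lyapunov_stable f z"
  with e(1) have "\<exists>d>0. \<forall>w. dist w z < d \<longrightarrow>
      (\<exists>x. x 0 = w \<and> forward_solution f x \<and> (\<forall>t\<ge>0. dist (x t) z < e))"
    unfolding lyapunov_stable_def by (elim allE[of _ e] impE)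
  then obtain d where d: "d > 0" "\<And>w. dist w z < d \<Longrightarrow>
      \<exists>x. x 0 = w \<and> forward_solution f x \<and> (\<forall>t\<ge>0. dist (x t) z < e)"
    by (elim exE conjE) (rule that, auto)
  have x0n: "x0 \<noteq> 0" using x0 by auto
  define s where "s = d / (2 * norm x0)"
  have s: "s > 0" using d x0n by (simp add: s_def)
  have "dist (z + s *\<^sub>R x0) z < d" using s d x0n by (simp add: dist_norm s_def)
  from d(2)[OF this] obtain x where x: "x 0 = z + s *\<^sub>R x0" "forward_solution f x" "\<And>t. t \<ge> 0 \<Longrightarrow> norm (x t - z) < e"
    unfolding dist_norm by (elim exE conjE) (rule that, auto)
  define \<phi> where "\<phi> \<tau> = (x \<tau> - z) \<bullet> (X *v (x \<tau> - z))" for \<tau>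
  define \<phi>' where "\<phi>' \<tau> = (x \<tau> - z) \<bullet> (X *v f (x \<tau>)) + f (x \<tau>) \<bullet> (X *v (x \<tau> - z))" for \<tau>
  have "(\<phi> has_derivative (\<lambda>h. h * \<phi>' \<tau>)) (at \<tau> within {0..})" if "\<tau> \<ge> 0" for \<tau>
  proof -
    have 1: "((\<lambda>\<tau>. x \<tau> - z) has_derivative (\<lambda>h. h *\<^sub>R f (x \<tau>))) (at \<tau> within {0..})"
    proof -
      have "(x has_derivative (\<lambda>h. h *\<^sub>R f (x \<tau>))) (at \<tau> within {0..})"
        using x(2) that by (simp add: forward_solution_def has_vector_derivative_def)
      from has_derivative_diff[OF this has_derivative_const[of z]] show ?thesis by simp
    qed
    note 2 = bounded_linear.has_derivative[OF matrix_vector_mul_bounded_linear[of X] 1]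
    show ?thesis unfolding \<phi>_def
      by (rule has_derivative_eq_rhs[OF has_derivative_inner[OF 1 2]])
        (simp add: \<phi>'_def fun_eq_iff matrix_vector_mult_scaleR algebra_simps)
  qed
  then have d\<phi>: "(\<phi> has_real_derivative \<phi>' \<tau>) (at \<tau> within {0..})" if "\<tau> \<ge> 0" for \<tau>
    using that by (simp add: has_field_derivative_def mult_commute_abs)
  have ge: "\<phi>' \<tau> \<ge> t * \<phi> \<tau>" if "\<tau> \<ge> 0" for \<tau>
  proof -
    define y R where "y = x \<tau> - z" and "R = f (x \<tau>) - A *v y"
    have fx: "f (x \<tau>) = A *v y + R" by (simp add: R_def)
    have R: "norm R \<le> 1 / (2 * K) * norm y"
      using e(2)[OF x(3)[OF that]] by (simp add: R_def y_def f0)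
    have "\<bar>y \<bullet> (X *v R)\<bar> \<le> norm y * (norm R * K)"
      by (rule order_trans[OF Cauchy_Schwarz_ineq2 mult_left_mono[OF K(2) norm_ge_zero]])
    moreover have "\<bar>R \<bullet> (X *v y)\<bar> \<le> norm R * (norm y * K)"
      by (rule order_trans[OF Cauchy_Schwarz_ineq2 mult_left_mono[OF K(2) norm_ge_zero]])
    moreover have "norm y * (norm R * K) \<le> (norm y * norm y) / 2"
    proof -
      have "norm y * (norm R * K) \<le> norm y * ((1 / (2 * K) * norm y) * K)"
        using R K(1) by (intro mult_left_mono mult_right_mono) auto
      then show ?thesis using K(1) by simp
    qed
    ultimately have "y \<bullet> (X *v R) + R \<bullet> (X *v y) \<ge> - (y \<bullet> y)"
      by (simp add: power2_norm_eq_inner[symmetric] power2_eq_square mult_ac)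
    moreover have "\<phi>' \<tau> = t * \<phi> \<tau> + y \<bullet> y + (y \<bullet> (X *v R) + R \<bullet> (X *v y))"
      using form[of y] unfolding \<phi>_def \<phi>'_def y_def[symmetric] fx
      by (simp add: matrix_vector_right_distrib inner_add_left inner_add_right)
    ultimately show ?thesis by linarith
  qed
  define \<psi> where "\<psi> \<tau> = exp (- t * \<tau>) * \<phi> \<tau>" for \<tau>
  have d\<psi>: "(\<psi> has_real_derivative exp (- t * \<tau>) * (\<phi>' \<tau> - t * \<phi> \<tau>)) (at \<tau> within {0..})"
    if "\<tau> \<ge> 0" for \<tau>
  proof -
    have "((\<lambda>\<tau>. exp (- t * \<tau>)) has_real_derivative exp (- t * \<tau>) * (- t)) (at \<tau> within {0..})"
      by (auto intro!: derivative_eq_intros)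
    from DERIV_mult[OF this d\<phi>[OF that]] show ?thesis
      unfolding \<psi>_def by (simp add: algebra_simps)
  qed
  have mono: "\<psi> 0 \<le> \<psi> \<tau>" if "\<tau> > 0" for \<tau>
  proof (rule DERIV_nonneg_imp_increasing_open[of 0 \<tau> \<psi>])
    fix u :: real assume u: "0 < u" "u < \<tau>"
    have "(\<psi> has_real_derivative exp (- t * u) * (\<phi>' u - t * \<phi> u)) (at u)"
      using d\<psi>[of u] u at_within_interior[of u "{0..}"] by simp
    moreover have "exp (- t * u) * (\<phi>' u - t * \<phi> u) \<ge> 0" using ge[of u] u by simp
    ultimately show "\<exists>y. (\<psi> has_real_derivative y) (at u) \<and> 0 \<le> y" by blast
  next
    have "continuous_on {0..} \<psi>"
      using d\<psi> by (auto simp: continuous_on_eq_continuous_within intro: DERIV_continuous)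
    then show "continuous_on {0..\<tau>} \<psi>" by (rule continuous_on_subset) auto
  qed (use that in auto)
  have \<phi>0: "\<phi> 0 > 0"
    using x0 s by (simp add: \<phi>_def x(1) matrix_vector_mult_scaleR)
  have le: "\<phi> \<tau> \<le> K * e\<^sup>2" if "\<tau> \<ge> 0" for \<tau>
  proof -
    let ?y = "x \<tau> - z"
    have "\<phi> \<tau> \<le> norm ?y * (norm ?y * K)"
      unfolding \<phi>_def by (rule order_trans[OF norm_cauchy_schwarz mult_left_mono[OF K(2) norm_ge_zero]])
    also have "\<dots> = K * (norm ?y)\<^sup>2" by (simp add: power2_eq_square)
    also have "\<dots> \<le> K * e\<^sup>2" using x(3)[OF that] K(1) by (intro mult_left_mono power_mono) auto
    finally show ?thesis .
  qed
  (* At this time the lower bound exp (t \<tau>) \<phi>(0) exceeds the upper bound K e^2 = t \<tau> \<phi>(0). *)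
  define \<tau> where "\<tau> = K * e\<^sup>2 / (t * \<phi> 0)"
  have \<tau>: "\<tau> > 0" using K e t \<phi>0 by (simp add: \<tau>_def)
  have "\<phi> 0 \<le> exp (- t * \<tau>) * \<phi> \<tau>" using mono[OF \<tau>] by (simp add: \<psi>_def)
  then have "exp (t * \<tau>) * \<phi> 0 \<le> exp (t * \<tau>) * (exp (- t * \<tau>) * \<phi> \<tau>)" by simp
  also have "\<dots> = \<phi> \<tau>" by (simp add: mult.assoc[symmetric] exp_add[symmetric])
  also have "\<dots> \<le> K * e\<^sup>2" using le \<tau> by simp
  also have "\<dots> = t * \<tau> * \<phi> 0" using t \<phi>0 by (simp add: \<tau>_def)
  finally have "exp (t * \<tau>) \<le> t * \<tau>" using \<phi>0 by simp
  with exp_ge_add_one_self[of "t * \<tau>"] show False by linarith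
qed

section \<open>The linearized equations of motion\<close>

definition kepler :: "real ^ 3 \<Rightarrow> real ^ 3" where
  "kepler s = (1 / norm s ^ 3) *\<^sub>R s"

definition kepler' :: "real ^ 3 \<Rightarrow> real ^ 3 \<Rightarrow> real ^ 3" where
  "kepler' s h = (1 / norm s ^ 3) *\<^sub>R h - (3 * (s \<bullet> h) / norm s ^ 5) *\<^sub>R s"

lemma has_derivative_kepler [derivative_intros]:
  assumes f: "(f has_derivative f') (at x)" and nz: "f x \<noteq> 0"
  shows "((\<lambda>x. kepler (f x)) has_derivative (\<lambda>h. kepler' (f x) (f' h))) (at x)"
proof -
  have "GDERIV (\<lambda>u. 1 / norm u) (f x) :> (- (1 / norm (f x) ^ 3)) *\<^sub>R f x"
    using GDERIV_inverse_norm[of 0 1 "f x" 1] nz by simp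
  then have "((\<lambda>u. 1 / norm u) has_derivative (\<lambda>h. h \<bullet> ((- (1 / norm (f x) ^ 3)) *\<^sub>R f x))) (at (f x))"
    by (simp add: gderiv_def)
  from has_derivative_power[OF has_derivative_compose[OF f this], of 3]
  have "((\<lambda>x. (1 / norm (f x)) ^ 3) has_derivative
      (\<lambda>h. - 3 * (f x \<bullet> f' h) / norm (f x) ^ 5)) (at x)"
    using nz by (elim has_derivative_eq_rhs)
      (auto simp: fun_eq_iff inner_commute power_divide field_simps eval_nat_numeral)
  from has_derivative_scaleR[OF this f] show ?thesis
    unfolding kepler_def kepler'_def power_divide power_one
    by (elim has_derivative_eq_rhs) (simp add: fun_eq_iff)
qed

lemma has_derivative_cross [derivative_intros]:
  assumes "(f has_derivative f') (at x)" "(g has_derivative g') (at x)"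
  shows "((\<lambda>x. f x \<times> g x) has_derivative (\<lambda>h. (f x \<times> g' h) + (f' h \<times> g x))) (at x)"
proof -
  have "bounded_bilinear (\<times>)" using bilinear_cross by (simp add: bilinear_conv_bounded_bilinear)
  from bounded_bilinear.FDERIV[OF this assms] show ?thesis .
qed

lemma bounded_linear_blk: "bounded_linear (\<lambda>z. blk z k)"
  by (intro linear_conv_bounded_linear[THEN iffD1] linearI) (simp_all add: blk_def vec_eq_iff)

lemmas has_derivative_blk [derivative_intros] = bounded_linear.has_derivative[OF bounded_linear_blk]

lemma has_derivative_of_blocks:
  assumes "\<And>k. ((\<lambda>z. v z k) has_derivative (\<lambda>h. v' h k)) (at x)"
  shows "((\<lambda>z. of_blocks (v z)) has_derivative (\<lambda>h. of_blocks (v' h))) (at x)"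
proof (subst has_derivative_componentwise_within, rule ballI)
  fix i :: state assume "i \<in> Basis"
  then obtain k j where "i = axis (k, j) 1" by (auto simp: Basis_vec_def)
  moreover have "((\<lambda>z. v z k $ j) has_derivative (\<lambda>h. v' h k $ j)) (at x)"
    by (rule bounded_linear.has_derivative[OF bounded_linear_vec_nth assms])
  ultimately show "((\<lambda>z. of_blocks (v z) \<bullet> i) has_derivative (\<lambda>h. of_blocks (v' h) \<bullet> i)) (at x)"
    by (simp add: inner_axis of_blocks_def)
qed

definition collision_free :: "real \<Rightarrow> real \<Rightarrow> state \<Rightarrow> bool" where
  "collision_free m1 m2 z \<longleftrightarrow> blk z Lam \<noteq> 0
     \<and> blk z Mu - (m2 / (m1 + m2)) *\<^sub>R blk z Lam \<noteq> 0 \<and> blk z Mu + (m1 / (m1 + m2)) *\<^sub>R blk z Lam \<noteq> 0"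

lemma open_collision_free: "open {z. collision_free m1 m2 z}"
proof -
  have c: "continuous_on UNIV (\<lambda>z. blk z k)" for k
    by (rule linear_continuous_on[OF bounded_linear_blk])
  show ?thesis unfolding collision_free_def
    by (intro open_Collect_conj open_Collect_neq continuous_intros c)
qed

text \<open>The gradients of the potential are combinations of three force kernels, one for each side of the
triangle. The kernels are arguments so that the same combination yields the gradients (for \<open>kepler\<close>)
and their derivatives (for \<open>kepler'\<close> at the sides of the configuration).\<close>
definition grad_lam :: "real \<Rightarrow> real \<Rightarrow> real \<Rightarrow> real \<Rightarrow> (real ^ 3 \<Rightarrow> real ^ 3) \<Rightarrow>
    (real ^ 3 \<Rightarrow> real ^ 3) \<Rightarrow> (real ^ 3 \<Rightarrow> real ^ 3) \<Rightarrow> real ^ 3 \<Rightarrow> real ^ 3 \<Rightarrow> real ^ 3" where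
  "grad_lam G m0 m1 m2 K0 K1 K2 lam mu =
     (G * m1 * m2) *\<^sub>R K0 lam
     - (G * m1 * m0 * (m2 / (m1 + m2))) *\<^sub>R K1 (mu - (m2 / (m1 + m2)) *\<^sub>R lam)
     + (G * m2 * m0 * (m1 / (m1 + m2))) *\<^sub>R K2 (mu + (m1 / (m1 + m2)) *\<^sub>R lam)"

definition grad_mu :: "real \<Rightarrow> real \<Rightarrow> real \<Rightarrow> real \<Rightarrow> (real ^ 3 \<Rightarrow> real ^ 3) \<Rightarrow>
    (real ^ 3 \<Rightarrow> real ^ 3) \<Rightarrow> real ^ 3 \<Rightarrow> real ^ 3 \<Rightarrow> real ^ 3" where
  "grad_mu G m0 m1 m2 K1 K2 lam mu =
     (G * m1 * m0) *\<^sub>R K1 (mu - (m2 / (m1 + m2)) *\<^sub>R lam)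
     + (G * m2 * m0) *\<^sub>R K2 (mu + (m1 / (m1 + m2)) *\<^sub>R lam)"

definition point_mass_field ::
  "real \<Rightarrow> real \<Rightarrow> real \<Rightarrow> real \<Rightarrow> real \<Rightarrow> real \<Rightarrow> real \<Rightarrow> state \<Rightarrow> state" where
  "point_mass_field G m0 m1 m2 A0 C0 l z =
    (let \<Omega> = Omega_gyro A0 C0 l (blk z Pi0) in of_blocks (\<lambda>k. case k of
          Pi1 \<Rightarrow> 0
        | Pi2 \<Rightarrow> 0
        | Pi0 \<Rightarrow> blk z Pi0 \<times> \<Omega>
        | Lam \<Rightarrow> (1 / (m1 * m2 / (m1 + m2))) *\<^sub>R blk z PLam + (blk z Lam \<times> \<Omega>)
        | PLam \<Rightarrow> (blk z PLam \<times> \<Omega>) - grad_lam G m0 m1 m2 kepler kepler kepler (blk z Lam) (blk z Mu)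
        | Mu \<Rightarrow> (1 / (m0 * (m1 + m2) / (m0 + m1 + m2))) *\<^sub>R blk z PMu + (blk z Mu \<times> \<Omega>)
        | PMu \<Rightarrow> (blk z PMu \<times> \<Omega>) - grad_mu G m0 m1 m2 kepler kepler (blk z Lam) (blk z Mu)))"

text \<open>The torque vanishes because each force acts along a side of the triangle, and the spin of a sphere is
parallel to its momentum.\<close>
lemma eq_motion_eq_point_mass_field:
  assumes z: "collision_free m1 m2 z" and pos: "A1 > 0" "A2 > 0"
  shows "eq_motion G m0 m1 m2 A0 C0 A1 A1 A2 A2 l z = point_mass_field G m0 m1 m2 A0 C0 l z"
proof -
  have spin: "P \<times> Omega_rigid A A P = 0" if "A > 0" for A P
    using that by (simp add: Omega_rigid_def matrix_inv_inertia cross3_def vec_eq_iff forall_3)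
  have gl: "grad (\<lambda>u. potential G m0 m1 m2 u (blk z Mu)) (blk z Lam)
      = grad_lam G m0 m1 m2 kepler kepler kepler (blk z Lam) (blk z Mu)"
    using z by (simp add: collision_free_def grad_potential_lam grad_lam_def kepler_def)
  have gm: "grad (\<lambda>u. potential G m0 m1 m2 (blk z Lam) u) (blk z Mu)
      = grad_mu G m0 m1 m2 kepler kepler (blk z Lam) (blk z Mu)"
    using z by (simp add: collision_free_def grad_potential_mu grad_mu_def kepler_def)
  have torque: "(lam \<times> grad_lam G m0 m1 m2 kepler kepler kepler lam mu)
      + (mu \<times> grad_mu G m0 m1 m2 kepler kepler lam mu) = 0" for lam mu
  proof -
    have "(lam \<times> (p *\<^sub>R n0 *\<^sub>R lam - (q * a) *\<^sub>R n1 *\<^sub>R (mu - a *\<^sub>R lam) + (r * b) *\<^sub>R n2 *\<^sub>R (mu + b *\<^sub>R lam)))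
      + (mu \<times> (q *\<^sub>R n1 *\<^sub>R (mu - a *\<^sub>R lam) + r *\<^sub>R n2 *\<^sub>R (mu + b *\<^sub>R lam))) = 0"
      for p q r a b n0 n1 n2 :: real
      by (simp add: cross3_def vec_eq_iff forall_3) (simp add: algebra_simps)
    then show ?thesis unfolding grad_lam_def grad_mu_def kepler_def .
  qed
  show ?thesis
    unfolding eq_motion_def point_mass_field_def Let_def gl gm spin[OF pos(1)] spin[OF pos(2)]
    by (simp add: torque add.assoc cong: block.case_cong)
qed

definition linearized_field ::
  "real \<Rightarrow> real \<Rightarrow> real \<Rightarrow> real \<Rightarrow> real \<Rightarrow> real \<Rightarrow> real \<Rightarrow> state \<Rightarrow> state \<Rightarrow> state" where
  "linearized_field G m0 m1 m2 A0 C0 l z h =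
    (let \<Omega> = Omega_gyro A0 C0 l (blk z Pi0); \<Omega>' = Omega_gyro A0 C0 0 (blk h Pi0);
         K0 = kepler' (blk z Lam);
         K1 = kepler' (blk z Mu - (m2 / (m1 + m2)) *\<^sub>R blk z Lam);
         K2 = kepler' (blk z Mu + (m1 / (m1 + m2)) *\<^sub>R blk z Lam)
     in of_blocks (\<lambda>k. case k of
          Pi1 \<Rightarrow> 0
        | Pi2 \<Rightarrow> 0
        | Pi0 \<Rightarrow> (blk z Pi0 \<times> \<Omega>') + (blk h Pi0 \<times> \<Omega>)
        | Lam \<Rightarrow> (1 / (m1 * m2 / (m1 + m2))) *\<^sub>R blk h PLam + ((blk z Lam \<times> \<Omega>') + (blk h Lam \<times> \<Omega>))
        | PLam \<Rightarrow> ((blk z PLam \<times> \<Omega>') + (blk h PLam \<times> \<Omega>)) - grad_lam G m0 m1 m2 K0 K1 K2 (blk h Lam) (blk h Mu)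
        | Mu \<Rightarrow> (1 / (m0 * (m1 + m2) / (m0 + m1 + m2))) *\<^sub>R blk h PMu + ((blk z Mu \<times> \<Omega>') + (blk h Mu \<times> \<Omega>))
        | PMu \<Rightarrow> ((blk z PMu \<times> \<Omega>') + (blk h PMu \<times> \<Omega>)) - grad_mu G m0 m1 m2 K1 K2 (blk h Lam) (blk h Mu)))"

lemma has_derivative_eq_motion:
  assumes z: "collision_free m1 m2 z" and pos: "A1 > 0" "A2 > 0"
  shows "(eq_motion G m0 m1 m2 A0 C0 A1 A1 A2 A2 l has_derivative
     linearized_field G m0 m1 m2 A0 C0 l z) (at z)"
proof (rule has_derivative_transform_within_open[OF _ open_collision_free])
  have grv0: "gyr_momentum 0 = 0" by (simp add: gyr_momentum_def vec_eq_iff forall_3)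
  have \<Omega>: "((\<lambda>z. Omega_gyro A0 C0 l (blk z Pi0)) has_derivative
      (\<lambda>h. Omega_gyro A0 C0 0 (blk h Pi0))) (at z)"
    unfolding Omega_gyro_def grv0
    by (rule has_derivative_eq_rhs[OF bounded_linear.has_derivative[OF matrix_vector_mul_bounded_linear
      has_derivative_diff[OF has_derivative_blk[OF has_derivative_ident] has_derivative_const]]]) simp
  have nz: "blk z Lam \<noteq> 0" "blk z Mu - (m2 / (m1 + m2)) *\<^sub>R blk z Lam \<noteq> 0"
    "blk z Mu + (m1 / (m1 + m2)) *\<^sub>R blk z Lam \<noteq> 0"
    using z unfolding collision_free_def by blast+
  show "(point_mass_field G m0 m1 m2 A0 C0 l has_derivative linearized_field G m0 m1 m2 A0 C0 l z) (at z)"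
    unfolding point_mass_field_def[abs_def] linearized_field_def[abs_def] Let_def
    unfolding grad_lam_def grad_mu_def
    apply (rule has_derivative_of_blocks)
    subgoal for k
      by (cases k; simp only: block.case;
        intro has_derivative_add has_derivative_diff has_derivative_scaleR_right has_derivative_cross
          has_derivative_kepler has_derivative_blk has_derivative_ident has_derivative_const \<Omega> nz)
    done
  show "z \<in> {z. collision_free m1 m2 z}" using z by simp
  show "point_mass_field G m0 m1 m2 A0 C0 l x = eq_motion G m0 m1 m2 A0 C0 A1 A1 A2 A2 l x"
    if "x \<in> {z. collision_free m1 m2 z}" for x
    using that pos by (simp add: eq_motion_eq_point_mass_field)
qed

lemma Re_Im_map_matrix_mult:
  "(map_matrix complex_of_real J *v v) $ p =
     Complex ((J *v (\<chi> q. Re (v $ q))) $ p) ((J *v (\<chi> q. Im (v $ q))) $ p)"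
  by (simp add: complex_eq_iff matrix_vector_mult_def)

lemma jacobian_mult:
  assumes "(f has_derivative D) (at z)"
  shows "jacobian f z *v h = D h"
proof -
  have "frechet_derivative f (at z) = D" using frechet_derivative_at[OF assms] by simp
  then show ?thesis using has_derivative_linear[OF assms]
    by (simp add: jacobian_def linear_matrix_vector_mul_eq matrix_works)
qed

section \<open>Linearization at the equilateral triangle\<close>

text \<open>The second coordinate of \<open>\<mu>\<close> is \<open>\<eta> Z\<close> with \<open>\<eta> = \<plusminus> \<surd>3 / 2\<close>. Stating this as \<open>\<eta>\<^sup>2 = 3/4\<close> treats both
orientations of the triangle at once.\<close>

locale equilateral_configuration =
  fixes G m0 m1 m2 A0 C0 A1 A2 l Z \<omega> x2 \<eta> :: real and ze :: state
  assumes pos: "G > 0" "m0 > 0" "m1 > 0" "m2 > 0" "A0 > 0" "C0 > 0" "A1 > 0" "A2 > 0" "Z > 0"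
    and \<eta>: "\<eta> * \<eta> = 3 / 4"
    and x2: "x2 = Z * (m2 - m1) / (2 * (m1 + m2))"
    and \<omega>: "\<omega>\<^sup>2 = G * (m0 + m1 + m2) / Z ^ 3"
    and Lam: "blk ze Lam = vector [Z, 0, 0]"
    and PLam: "blk ze PLam = (m1 * m2 / (m1 + m2) * \<omega>) *\<^sub>R vector [0, Z, 0]"
    and Mu: "blk ze Mu = vector [x2, \<eta> * Z, 0]"
    and PMu: "blk ze PMu = (m0 * (m1 + m2) / (m0 + m1 + m2) * \<omega>) *\<^sub>R vector [- (\<eta> * Z), x2, 0]"
    and Pi0: "blk ze Pi0 = vector [0, 0, C0 * \<omega> + l]"
begin

text \<open>The mass factors disappear from the equations in terms of the side \<open>\<lambda>\<close> from \<open>S\<^sub>1\<close> to \<open>S\<^sub>2\<close>, the side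
\<open>rel\<close> from \<open>S\<^sub>0\<close> to \<open>S\<^sub>1\<close>, and the velocities of
these sides in an inertial frame. The definitions are polymorphic because they are
applied both to real states and to complex eigenvectors.\<close>
definition "vel_lam v i = v $ (PLam, i) / of_real (m1 * m2 / (m1 + m2))"
  for v :: "'a::real_field ^ (block \<times> 3)"

definition "rel v i = v $ (Mu, i) - of_real (m2 / (m1 + m2)) * v $ (Lam, i)"
  for v :: "'a::real_field ^ (block \<times> 3)"

definition "vel_rel v i = v $ (PMu, i) / of_real (m0 * (m1 + m2) / (m0 + m1 + m2))
    - of_real (m2 / (m1 + m2)) * vel_lam v i"
  for v :: "'a::real_field ^ (block \<times> 3)"

lemma masses: "m1 + m2 > 0" "m0 + m1 + m2 > 0" using pos by auto

lemma sides:
  "blk ze Mu - (m2 / (m1 + m2)) *\<^sub>R blk ze Lam = vector [- Z / 2, \<eta> * Z, 0]"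
  "blk ze Mu + (m1 / (m1 + m2)) *\<^sub>R blk ze Lam = vector [Z / 2, \<eta> * Z, 0]"
proof -
  have "x2 - m2 / (m1 + m2) * Z = - Z / 2" "x2 + m1 / (m1 + m2) * Z = Z / 2"
    using masses by (simp_all add: x2 divide_simps) (simp_all add: algebra_simps)
  then show "blk ze Mu - (m2 / (m1 + m2)) *\<^sub>R blk ze Lam = vector [- Z / 2, \<eta> * Z, 0]"
    "blk ze Mu + (m1 / (m1 + m2)) *\<^sub>R blk ze Lam = vector [Z / 2, \<eta> * Z, 0]"
    by (simp_all add: Mu Lam vec_eq_iff forall_3)
qed

lemma norm_sides:
  "norm (vector [Z, 0, 0] :: real ^ 3) = Z"
  "norm (vector [- Z / 2, \<eta> * Z, 0] :: real ^ 3) = Z"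
  "norm (vector [Z / 2, \<eta> * Z, 0] :: real ^ 3) = Z"
proof -
  have "\<eta> * Z * (\<eta> * Z) = (\<eta> * \<eta>) * (Z * Z)" by simp
  also have "\<dots> = 3 / 4 * (Z * Z)" by (simp only: \<eta>)
  finally have yy: "\<eta> * Z * (\<eta> * Z) = 3 / 4 * (Z * Z)" .
  show "norm (vector [Z, 0, 0] :: real ^ 3) = Z"
    "norm (vector [- Z / 2, \<eta> * Z, 0] :: real ^ 3) = Z"
    "norm (vector [Z / 2, \<eta> * Z, 0] :: real ^ 3) = Z"
    unfolding norm_eq_sqrt_inner inner_vec_def sum_3 using pos(9)
    by (auto simp: power2_eq_square yy intro!: real_sqrt_unique)
qed

lemma collision_free_ze: "collision_free m1 m2 ze"
proof -
  have "vector [Z, 0, 0] \<noteq> (0 :: real ^ 3)" "vector [- Z / 2, \<eta> * Z, 0] \<noteq> (0 :: real ^ 3)"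
    "vector [Z / 2, \<eta> * Z, 0] \<noteq> (0 :: real ^ 3)"
    using norm_sides pos by (metis norm_zero less_irrefl)+
  then show ?thesis unfolding collision_free_def sides unfolding Lam by blast
qed

text \<open>The derivative of \<open>kepler\<close> at a side is \<open>1/Z\<^sup>3\<close> times the identity minus three times the projection
to that side.\<close>
lemma kepler'_sides:
  "kepler' (vector [Z, 0, 0]) h = (1 / Z ^ 3) *\<^sub>R vector [- 2 * h $ 1, h $ 2, h $ 3]"
  "kepler' (vector [- Z / 2, \<eta> * Z, 0]) h = (1 / Z ^ 3) *\<^sub>R
     vector [h $ 1 / 4 + 3 / 2 * \<eta> * h $ 2, 3 / 2 * \<eta> * h $ 1 - 5 / 4 * h $ 2, h $ 3]"
  "kepler' (vector [Z / 2, \<eta> * Z, 0]) h = (1 / Z ^ 3) *\<^sub>R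
     vector [h $ 1 / 4 - 3 / 2 * \<eta> * h $ 2, - 3 / 2 * \<eta> * h $ 1 - 5 / 4 * h $ 2, h $ 3]"
proof -
  have "\<eta> * (\<eta> * x) = 3 / 4 * x" for x using \<eta> by (metis mult.assoc)
  note \<eta>' = this
  have "Z ^ 5 = Z * Z * Z ^ 3" by (simp add: eval_nat_numeral)
  note Z5 = this
  show "kepler' (vector [Z, 0, 0]) h = (1 / Z ^ 3) *\<^sub>R vector [- 2 * h $ 1, h $ 2, h $ 3]"
    unfolding kepler'_def norm_sides inner_vec_def sum_3 Z5 using pos
    by (simp add: vec_eq_iff forall_3 field_simps)
  show "kepler' (vector [- Z / 2, \<eta> * Z, 0]) h = (1 / Z ^ 3) *\<^sub>R
     vector [h $ 1 / 4 + 3 / 2 * \<eta> * h $ 2, 3 / 2 * \<eta> * h $ 1 - 5 / 4 * h $ 2, h $ 3]"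
    unfolding kepler'_def norm_sides inner_vec_def sum_3 Z5 using pos
    by (simp add: vec_eq_iff forall_3 field_simps \<eta>')
  show "kepler' (vector [Z / 2, \<eta> * Z, 0]) h = (1 / Z ^ 3) *\<^sub>R
     vector [h $ 1 / 4 - 3 / 2 * \<eta> * h $ 2, - 3 / 2 * \<eta> * h $ 1 - 5 / 4 * h $ 2, h $ 3]"
    unfolding kepler'_def norm_sides inner_vec_def sum_3 Z5 using pos
    by (simp add: vec_eq_iff forall_3 field_simps \<eta>')
qed

lemma Omega_gyro_eq:
  "Omega_gyro A0 C0 l (blk ze Pi0) = vector [0, 0, \<omega>]"
  "Omega_gyro A0 C0 0 P = vector [P $ 1 / A0, P $ 2 / A0, P $ 3 / C0]"
  using pos by (simp_all add: Omega_gyro_def matrix_inv_inertia Pi0 gyr_momentum_def vec_eq_iff forall_3)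

abbreviation "field \<equiv> eq_motion G m0 m1 m2 A0 C0 A1 A1 A2 A2 l"
abbreviation "lin \<equiv> linearized_field G m0 m1 m2 A0 C0 l ze"
abbreviation "\<kappa> \<equiv> G / Z ^ 3"

lemma jacobian_field: "jacobian field ze *v h = lin h"
  by (rule jacobian_mult[OF has_derivative_eq_motion[OF collision_free_ze pos(7,8)]])

lemma third_side: "blk h Mu + (m1 / (m1 + m2)) *\<^sub>R blk h Lam = (\<chi> i. rel h i + h $ (Lam, i))"
  and second_side: "blk h Mu - (m2 / (m1 + m2)) *\<^sub>R blk h Lam = (\<chi> i. rel h i)"
proof -
  have "m1 / (m1 + m2) * x = x - m2 / (m1 + m2) * x" for x
    using masses by (simp add: field_simps)
  then show "blk h Mu + (m1 / (m1 + m2)) *\<^sub>R blk h Lam = (\<chi> i. rel h i + h $ (Lam, i))"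
    by (simp add: vec_eq_iff blk_def rel_def)
  show "blk h Mu - (m2 / (m1 + m2)) *\<^sub>R blk h Lam = (\<chi> i. rel h i)"
    by (simp add: vec_eq_iff blk_def rel_def)
qed

lemma lin_spin:
  "lin h $ (Pi1, i) = 0" "lin h $ (Pi2, i) = 0"
  "lin h $ (Pi0, 1) = (\<omega> - (C0 * \<omega> + l) / A0) * h $ (Pi0, 2)"
  "lin h $ (Pi0, 2) = - (\<omega> - (C0 * \<omega> + l) / A0) * h $ (Pi0, 1)"
  "lin h $ (Pi0, 3) = 0"
  unfolding linearized_field_def Let_def of_blocks_def Omega_gyro_eq unfolding Pi0
  by (simp_all add: cross3_def blk_def algebra_simps)

lemma lin_positions:
  "lin h $ (Lam, 1) = vel_lam h 1 + \<omega> * h $ (Lam, 2)"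
  "lin h $ (Lam, 2) = vel_lam h 2 - \<omega> * h $ (Lam, 1) - Z * (h $ (Pi0, 3) / C0)"
  "lin h $ (Lam, 3) = vel_lam h 3 + Z * (h $ (Pi0, 2) / A0)"
  "lin h $ (Mu, 1) = h $ (PMu, 1) / (m0 * (m1 + m2) / (m0 + m1 + m2)) + \<omega> * h $ (Mu, 2) + \<eta> * Z * (h $ (Pi0, 3) / C0)"
  "lin h $ (Mu, 2) = h $ (PMu, 2) / (m0 * (m1 + m2) / (m0 + m1 + m2)) - \<omega> * h $ (Mu, 1) - x2 * (h $ (Pi0, 3) / C0)"
  "lin h $ (Mu, 3) = h $ (PMu, 3) / (m0 * (m1 + m2) / (m0 + m1 + m2))
     + x2 * (h $ (Pi0, 2) / A0) - \<eta> * Z * (h $ (Pi0, 1) / A0)"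
  unfolding linearized_field_def Let_def of_blocks_def Omega_gyro_eq unfolding Lam Mu
  by (simp_all add: cross3_def blk_def vel_lam_def)

text \<open>These two identities turn the gradients, divided by the reduced masses, into accelerations of the
sides.\<close>
lemma acceleration_lam:
  "(t - (G * m1 * m2 * (1 / Z ^ 3 * k0) - G * m1 * m0 * (m2 / (m1 + m2)) * (1 / Z ^ 3 * k1)
      + G * m2 * m0 * (m1 / (m1 + m2)) * (1 / Z ^ 3 * k2))) / (m1 * m2 / (m1 + m2))
   = t / (m1 * m2 / (m1 + m2)) - \<kappa> * ((m1 + m2) * k0 - m0 * k1 + m0 * k2)"
proof -
  have "(t - (G * m1 * m2 * (u * k0) - G * m1 * m0 * (m2 / S) * (u * k1)
      + G * m2 * m0 * (m1 / S) * (u * k2))) / (m1 * m2 / S)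
    = t / (m1 * m2 / S) - G * u * (S * k0 - m0 * k1 + m0 * k2)" if "S > 0" for S u
    using that pos(3,4) by (simp add: field_simps)
  from this[OF masses(1), of "1 / Z ^ 3"] show ?thesis by simp
qed

lemma acceleration_mu:
  "(t - (G * m1 * m0 * (1 / Z ^ 3 * k1) + G * m2 * m0 * (1 / Z ^ 3 * k2))) / (m0 * (m1 + m2) / (m0 + m1 + m2))
     - m2 / (m1 + m2) * (t' - \<kappa> * ((m1 + m2) * k0 - m0 * k1 + m0 * k2))
   = t / (m0 * (m1 + m2) / (m0 + m1 + m2)) - m2 / (m1 + m2) * t'
     - \<kappa> * ((m0 + m1) * k1 + m2 * k2 - m2 * k0)"
proof -
  have "(t - (G * m1 * m0 * (u * k1) + G * m2 * m0 * (u * k2))) / (m0 * S / (m0 + S))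
     - m2 / S * (t' - G * u * (S * k0 - m0 * k1 + m0 * k2))
   = t / (m0 * S / (m0 + S)) - m2 / S * t' - G * u * ((m0 + m1) * k1 + m2 * k2 - m2 * k0)"
    if S: "S = m1 + m2" for S u
  proof -
    have "S > 0" "m0 + S > 0" using S pos by simp_all
    then show ?thesis using pos(2) unfolding S by (simp add: divide_simps) (simp add: algebra_simps)
  qed
  from this[OF refl, of "1 / Z ^ 3"] show ?thesis by (simp add: add.assoc)
qed

lemma x2_minus: "x2 * c - m2 / (m1 + m2) * (Z * c) = - Z / 2 * c"
proof -
  have "x2 - m2 / (m1 + m2) * Z = - Z / 2"
    using sides(1) by (simp add: Mu Lam vec_eq_iff forall_3)
  then show ?thesis by (metis left_diff_distrib mult.assoc)
qed

lemma lin_rel: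
  "rel (lin h) 1 = vel_rel h 1 + \<omega> * rel h 2 + \<eta> * Z * (h $ (Pi0, 3) / C0)"
  "rel (lin h) 2 = vel_rel h 2 - \<omega> * rel h 1 + Z / 2 * (h $ (Pi0, 3) / C0)"
  "rel (lin h) 3 = vel_rel h 3 - Z / 2 * (h $ (Pi0, 2) / A0) - \<eta> * Z * (h $ (Pi0, 1) / A0)"
proof -
  show "rel (lin h) 1 = vel_rel h 1 + \<omega> * rel h 2 + \<eta> * Z * (h $ (Pi0, 3) / C0)"
    unfolding rel_def vel_rel_def lin_positions of_real_eq_id id_apply
    by (simp add: right_diff_distrib distrib_left) 
  show "rel (lin h) 2 = vel_rel h 2 - \<omega> * rel h 1 + Z / 2 * (h $ (Pi0, 3) / C0)"
    unfolding rel_def vel_rel_def lin_positions of_real_eq_id id_apply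
    using x2_minus[of "h $ (Pi0, 3) / C0"] by argo
  show "rel (lin h) 3 = vel_rel h 3 - Z / 2 * (h $ (Pi0, 2) / A0) - \<eta> * Z * (h $ (Pi0, 1) / A0)"
    unfolding rel_def vel_rel_def lin_positions of_real_eq_id id_apply
    using x2_minus[of "h $ (Pi0, 2) / A0"] by argo
qed

lemma lin_momenta:
  "lin h $ (PLam, i) = ((blk ze PLam \<times> vector [h $ (Pi0, 1) / A0, h $ (Pi0, 2) / A0, h $ (Pi0, 3) / C0])
     + (blk h PLam \<times> vector [0, 0, \<omega>])) $ i
     - (G * m1 * m2 * (1 / Z ^ 3 * vector [- 2 * h $ (Lam, 1), h $ (Lam, 2), h $ (Lam, 3)] $ i)
       - G * m1 * m0 * (m2 / (m1 + m2)) * (1 / Z ^ 3 * vector [rel h 1 / 4 + 3 / 2 * \<eta> * rel h 2,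
          3 / 2 * \<eta> * rel h 1 - 5 / 4 * rel h 2, rel h 3] $ i)
       + G * m2 * m0 * (m1 / (m1 + m2)) * (1 / Z ^ 3 * vector [(rel h 1 + h $ (Lam, 1)) / 4 - 3 / 2 * \<eta> * (rel h 2 + h $ (Lam, 2)),
          - 3 / 2 * \<eta> * (rel h 1 + h $ (Lam, 1)) - 5 / 4 * (rel h 2 + h $ (Lam, 2)), rel h 3 + h $ (Lam, 3)] $ i))"
  "lin h $ (PMu, i) = ((blk ze PMu \<times> vector [h $ (Pi0, 1) / A0, h $ (Pi0, 2) / A0, h $ (Pi0, 3) / C0])
     + (blk h PMu \<times> vector [0, 0, \<omega>])) $ i
     - (G * m1 * m0 * (1 / Z ^ 3 * vector [rel h 1 / 4 + 3 / 2 * \<eta> * rel h 2,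
          3 / 2 * \<eta> * rel h 1 - 5 / 4 * rel h 2, rel h 3] $ i)
       + G * m2 * m0 * (1 / Z ^ 3 * vector [(rel h 1 + h $ (Lam, 1)) / 4 - 3 / 2 * \<eta> * (rel h 2 + h $ (Lam, 2)),
          - 3 / 2 * \<eta> * (rel h 1 + h $ (Lam, 1)) - 5 / 4 * (rel h 2 + h $ (Lam, 2)), rel h 3 + h $ (Lam, 3)] $ i))"
  unfolding linearized_field_def Let_def of_blocks_def Omega_gyro_eq sides unfolding Lam
    grad_lam_def grad_mu_def second_side third_side kepler'_sides
  by (simp_all add: blk_def)

lemma lin_vel_lam:
  "vel_lam (lin h) 1 = \<omega> * vel_lam h 2 + \<omega> * Z * (h $ (Pi0, 3) / C0)
     - \<kappa> * ((m1 + m2) * (- 2 * h $ (Lam, 1)) - m0 * (rel h 1 / 4 + 3 / 2 * \<eta> * rel h 2)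
        + m0 * ((rel h 1 + h $ (Lam, 1)) / 4 - 3 / 2 * \<eta> * (rel h 2 + h $ (Lam, 2))))"
  "vel_lam (lin h) 2 = - \<omega> * vel_lam h 1
     - \<kappa> * ((m1 + m2) * h $ (Lam, 2) - m0 * (3 / 2 * \<eta> * rel h 1 - 5 / 4 * rel h 2)
        + m0 * (- 3 / 2 * \<eta> * (rel h 1 + h $ (Lam, 1)) - 5 / 4 * (rel h 2 + h $ (Lam, 2))))"
  "vel_lam (lin h) 3 = - \<omega> * Z * (h $ (Pi0, 1) / A0)
     - \<kappa> * ((m1 + m2) * h $ (Lam, 3) - m0 * rel h 3 + m0 * (rel h 3 + h $ (Lam, 3)))"
proof -
  define g where "g = m1 * m2 / (m1 + m2)"
  have g: "g \<noteq> 0" using pos(3,4) masses(1) by (simp add: g_def)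
  have spin: "(((g * \<omega>) *\<^sub>R vector [0, Z, 0]) \<times> vector [a, b, c]) + (p \<times> vector [0, 0, \<omega>])
    = vector [g * (\<omega> * Z * c + \<omega> * (p $ 2 / g)), g * (- \<omega> * (p $ 1 / g)), g * (- \<omega> * Z * a)]" for a b c p
    using g by (simp add: cross3_def vec_eq_iff forall_3 algebra_simps)
  show "vel_lam (lin h) 1 = \<omega> * vel_lam h 2 + \<omega> * Z * (h $ (Pi0, 3) / C0)
     - \<kappa> * ((m1 + m2) * (- 2 * h $ (Lam, 1)) - m0 * (rel h 1 / 4 + 3 / 2 * \<eta> * rel h 2)
        + m0 * ((rel h 1 + h $ (Lam, 1)) / 4 - 3 / 2 * \<eta> * (rel h 2 + h $ (Lam, 2))))"
    "vel_lam (lin h) 2 = - \<omega> * vel_lam h 1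
     - \<kappa> * ((m1 + m2) * h $ (Lam, 2) - m0 * (3 / 2 * \<eta> * rel h 1 - 5 / 4 * rel h 2)
        + m0 * (- 3 / 2 * \<eta> * (rel h 1 + h $ (Lam, 1)) - 5 / 4 * (rel h 2 + h $ (Lam, 2))))"
    "vel_lam (lin h) 3 = - \<omega> * Z * (h $ (Pi0, 1) / A0)
     - \<kappa> * ((m1 + m2) * h $ (Lam, 3) - m0 * rel h 3 + m0 * (rel h 3 + h $ (Lam, 3)))"
    unfolding vel_lam_def of_real_eq_id id_apply lin_momenta acceleration_lam
    unfolding PLam g_def[symmetric] spin vector_3
    by (simp_all only: nonzero_mult_div_cancel_left[OF g] blk_def vec_lambda_beta)
qed

lemma lin_vel_rel:
  "vel_rel (lin h) 1 = \<omega> * vel_rel h 2 - \<omega> * Z / 2 * (h $ (Pi0, 3) / C0)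
     - \<kappa> * ((m0 + m1) * (rel h 1 / 4 + 3 / 2 * \<eta> * rel h 2)
        + m2 * ((rel h 1 + h $ (Lam, 1)) / 4 - 3 / 2 * \<eta> * (rel h 2 + h $ (Lam, 2)))
        - m2 * (- 2 * h $ (Lam, 1)))"
  "vel_rel (lin h) 2 = - \<omega> * vel_rel h 1 + \<omega> * \<eta> * Z * (h $ (Pi0, 3) / C0)
     - \<kappa> * ((m0 + m1) * (3 / 2 * \<eta> * rel h 1 - 5 / 4 * rel h 2)
        + m2 * (- 3 / 2 * \<eta> * (rel h 1 + h $ (Lam, 1)) - 5 / 4 * (rel h 2 + h $ (Lam, 2)))
        - m2 * h $ (Lam, 2))"
  "vel_rel (lin h) 3 = \<omega> * Z / 2 * (h $ (Pi0, 1) / A0) - \<omega> * \<eta> * Z * (h $ (Pi0, 2) / A0)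
     - \<kappa> * ((m0 + m1) * rel h 3 + m2 * (rel h 3 + h $ (Lam, 3)) - m2 * h $ (Lam, 3))"
proof -
  define g where "g = m0 * (m1 + m2) / (m0 + m1 + m2)"
  have g: "g \<noteq> 0" using pos(2) masses by (simp add: g_def)
  have spin: "(((g * \<omega>) *\<^sub>R vector [- (\<eta> * Z), x2, 0]) \<times> vector [a, b, c]) + (p \<times> vector [0, 0, \<omega>])
    = vector [g * (\<omega> * (x2 * c) + \<omega> * (p $ 2 / g)), g * (\<omega> * \<eta> * Z * c - \<omega> * (p $ 1 / g)),
        g * (- \<omega> * \<eta> * Z * b - \<omega> * (x2 * a))]" for a b c p
    using g by (simp add: cross3_def vec_eq_iff forall_3 algebra_simps)
  have w: "\<omega> * (x2 * c) - m2 / (m1 + m2) * (\<omega> * Z * c) = - (\<omega> * Z / 2 * c)" for c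
    using arg_cong[OF x2_minus, of "\<lambda>x. \<omega> * x" c] by (simp add: algebra_simps)
  show "vel_rel (lin h) 1 = \<omega> * vel_rel h 2 - \<omega> * Z / 2 * (h $ (Pi0, 3) / C0)
     - \<kappa> * ((m0 + m1) * (rel h 1 / 4 + 3 / 2 * \<eta> * rel h 2)
        + m2 * ((rel h 1 + h $ (Lam, 1)) / 4 - 3 / 2 * \<eta> * (rel h 2 + h $ (Lam, 2)))
        - m2 * (- 2 * h $ (Lam, 1)))"
    unfolding vel_rel_def of_real_eq_id id_apply lin_vel_lam lin_momenta PMu g_def[symmetric] spin vector_3
    unfolding g_def acceleration_mu unfolding g_def[symmetric] nonzero_mult_div_cancel_left[OF g]
    using w[of "h $ (Pi0, 3) / C0"] by (simp add: blk_def algebra_simps)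
  show "vel_rel (lin h) 2 = - \<omega> * vel_rel h 1 + \<omega> * \<eta> * Z * (h $ (Pi0, 3) / C0)
     - \<kappa> * ((m0 + m1) * (3 / 2 * \<eta> * rel h 1 - 5 / 4 * rel h 2)
        + m2 * (- 3 / 2 * \<eta> * (rel h 1 + h $ (Lam, 1)) - 5 / 4 * (rel h 2 + h $ (Lam, 2)))
        - m2 * h $ (Lam, 2))"
    unfolding vel_rel_def of_real_eq_id id_apply lin_vel_lam lin_momenta PMu g_def[symmetric] spin vector_3
    unfolding g_def acceleration_mu unfolding g_def[symmetric] nonzero_mult_div_cancel_left[OF g]
    by (simp add: blk_def algebra_simps)
  show "vel_rel (lin h) 3 = \<omega> * Z / 2 * (h $ (Pi0, 1) / A0) - \<omega> * \<eta> * Z * (h $ (Pi0, 2) / A0)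
     - \<kappa> * ((m0 + m1) * rel h 3 + m2 * (rel h 3 + h $ (Lam, 3)) - m2 * h $ (Lam, 3))"
    unfolding vel_rel_def of_real_eq_id id_apply lin_vel_lam lin_momenta PMu g_def[symmetric] spin vector_3
    unfolding g_def acceleration_mu unfolding g_def[symmetric] nonzero_mult_div_cancel_left[OF g]
    using w[of "h $ (Pi0, 1) / A0"] by (simp add: algebra_simps)
qed
end

section \<open>Action on complex states\<close>

context equilateral_configuration
begin

definition "act v = map_matrix complex_of_real (jacobian field ze) *v v"

definition complexify :: "state \<Rightarrow> complex ^ (block \<times> 3)" where "complexify h = (\<chi> q. of_real (h $ q))"

lemma complexify_nth: "complexify h $ q = of_real (h $ q)" by (simp add: complexify_def)

lemma complexify_functionals:
  "rel (complexify h) i = of_real (rel h i)" "vel_lam (complexify h) i = of_real (vel_lam h i)"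
  "vel_rel (complexify h) i = of_real (vel_rel h i)"
  by (simp_all only: rel_def vel_lam_def vel_rel_def complexify_nth of_real_eq_id id_apply
      of_real_divide of_real_mult of_real_diff)

lemma complex_state_split: "v = complexify (\<chi> q. Re (v $ q)) + \<i> *s complexify (\<chi> q. Im (v $ q))"
  by (simp add: vec_eq_iff complexify_def complex_eq_iff)

lemma act_split: "act v = complexify (lin (\<chi> q. Re (v $ q))) + \<i> *s complexify (lin (\<chi> q. Im (v $ q)))"
  by (simp add: act_def vec_eq_iff Re_Im_map_matrix_mult jacobian_field complexify_def complex_eq_iff)

lemma functional_combination:
  "rel (u + c *s v) i = rel u i + c * rel v i"
  "vel_lam (u + c *s v) i = vel_lam u i + c * vel_lam v i"
  "vel_rel (u + c *s v) i = vel_rel u i + c * vel_rel v i"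
  for u v :: "complex ^ (block \<times> 3)"
  by (simp_all add: rel_def vel_lam_def vel_rel_def algebra_simps add_divide_distrib)

text \<open>The perturbation of the angular momentum of the gyrostat turns about the vertical axis at a constant
rate, independently of the remaining variables.\<close>
lemma act_spin:
  "act v $ (Pi1, i) = 0" "act v $ (Pi2, i) = 0"
  "act v $ (Pi0, 1) = of_real (\<omega> - (C0 * \<omega> + l) / A0) * v $ (Pi0, 2)"
  "act v $ (Pi0, 2) = - of_real (\<omega> - (C0 * \<omega> + l) / A0) * v $ (Pi0, 1)"
  "act v $ (Pi0, 3) = 0"
  by (simp_all only: act_split) (simp_all add: complexify_nth lin_spin complex_eq_iff)

lemma vertical_factor: "(m1 + m2) * x - m0 * y + m0 * (y + x) = (m0 + m1 + m2) * x"
  "(m0 + m1) * y + m2 * (y + x) - m2 * x = (m0 + m1 + m2) * y"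
  by (simp_all add: algebra_simps)

lemma kappa: "\<kappa> * (m0 + m1 + m2) = \<omega>\<^sup>2"
  by (simp add: \<omega>)

text \<open>All sides have the same length, so the vertical restoring force is the same multiple of the
displacement for each of them: the two vertical displacements are independent oscillators of
frequency \<open>\<omega>\<close>.\<close>
lemma act_vertical:
  assumes "\<And>i. v $ (Pi0, i) = 0"
  shows "act v $ (Lam, 3) = vel_lam v 3"
    "vel_lam (act v) 3 = - of_real (\<omega>\<^sup>2) * v $ (Lam, 3)"
    "rel (act v) 3 = vel_rel v 3"
    "vel_rel (act v) 3 = - of_real (\<omega>\<^sup>2) * rel v 3"
proof -
  let ?r = "\<chi> q. Re (v $ q)" and ?s = "\<chi> q. Im (v $ q)"
  have v: "v $ q = of_real (?r $ q) + \<i> * of_real (?s $ q)" for q by (simp add: complex_eq_iff)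
  have f: "vel_lam v i = of_real (vel_lam ?r i) + \<i> * of_real (vel_lam ?s i)"
    "rel v i = of_real (rel ?r i) + \<i> * of_real (rel ?s i)"
    "vel_rel v i = of_real (vel_rel ?r i) + \<i> * of_real (vel_rel ?s i)" for i
    by (subst complex_state_split, simp only: functional_combination complexify_functionals)+
  have k: "\<kappa> * ((m0 + m1 + m2) * x) = \<omega>\<^sup>2 * x" for x
    unfolding kappa[symmetric] by simp
  have z: "?r $ (Pi0, i) = 0" "?s $ (Pi0, i) = 0" for i using assms by simp_all
  show "act v $ (Lam, 3) = vel_lam v 3"
    unfolding f act_split by (simp add: complexify_nth lin_positions z[simplified])
  show "vel_lam (act v) 3 = - of_real (\<omega>\<^sup>2) * v $ (Lam, 3)"
    unfolding v[of "(Lam, 3)"] act_split functional_combination complexify_functionals lin_vel_lam z vertical_factor k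
    by (simp add: algebra_simps)
  show "rel (act v) 3 = vel_rel v 3"
    unfolding f act_split functional_combination complexify_functionals lin_rel z by simp
  show "vel_rel (act v) 3 = - of_real (\<omega>\<^sup>2) * rel v 3"
    unfolding f act_split functional_combination complexify_functionals lin_vel_rel z vertical_factor k
    by (simp add: algebra_simps)
qed

text \<open>With \<open>\<sigma> = \<i>\<close> these are the usual complex coordinates of a planar vector, with \<open>\<sigma> = - \<i>\<close> their
conjugates. On complex states the two are independent, and each formula below serves for both.
Accordingly \<open>\<rho> \<sigma>\<close> is a primitive cube root of unity, and the sides of the triangle are \<open>Z\<close>, \<open>Z \<rho>\<close>
and \<open>Z \<rho>\<^sup>2\<close>.\<close>
definition "planar_lam \<sigma> v = v $ (Lam, 1) + \<sigma> * v $ (Lam, 2)" for \<sigma> :: complex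
definition "planar_rel \<sigma> v = rel v 1 + \<sigma> * rel v 2" for \<sigma> :: complex
definition "planar_vel_lam \<sigma> v = vel_lam v 1 + \<sigma> * vel_lam v 2" for \<sigma> :: complex
definition "planar_vel_rel \<sigma> v = vel_rel v 1 + \<sigma> * vel_rel v 2" for \<sigma> :: complex
definition "\<rho> \<sigma> = - 1 / 2 + \<sigma> * of_real \<eta>" for \<sigma> :: complex

lemma planar_combination:
  "planar_lam \<sigma> (u + c *s v) = planar_lam \<sigma> u + c * planar_lam \<sigma> v"
  "planar_rel \<sigma> (u + c *s v) = planar_rel \<sigma> u + c * planar_rel \<sigma> v"
  "planar_vel_lam \<sigma> (u + c *s v) = planar_vel_lam \<sigma> u + c * planar_vel_lam \<sigma> v"
  "planar_vel_rel \<sigma> (u + c *s v) = planar_vel_rel \<sigma> u + c * planar_vel_rel \<sigma> v"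
  by (simp_all add: planar_lam_def planar_rel_def planar_vel_lam_def planar_vel_rel_def functional_combination algebra_simps)

lemma \<rho>_square:
  assumes "\<sigma> * \<sigma> = - 1"
  shows "\<rho> \<sigma> * \<rho> \<sigma> = \<rho> (- \<sigma>)"
proof -
  have e: "of_real \<eta> * of_real \<eta> = (3 / 4 :: complex)"
    unfolding of_real_mult[symmetric] \<eta> by simp
  have "\<sigma> * of_real \<eta> * (\<sigma> * of_real \<eta>) = - 3 / 4"
    using assms e by algebra
  then show ?thesis unfolding \<rho>_def by algebra
qed

text \<open>At a side \<open>s\<close> of length \<open>Z\<close> the derivative of \<open>kepler\<close> is \<open>h \<mapsto> - (h + 3 (s/Z)\<^sup>2 h') / 2\<close>
up to the factor \<open>1/Z\<^sup>3\<close>, where \<open>h'\<close> is the conjugate. The three lines are the sides with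
\<open>(s/Z)\<^sup>2\<close> equal to \<open>1\<close>, \<open>\<rho>\<^sup>2\<close> and \<open>\<rho>\<^sup>4 = \<rho>\<close>.\<close>
lemma tidal_complex:
  assumes s: "\<sigma> * \<sigma> = - 1"
  shows "- 2 * a + \<sigma> * b = - (a + \<sigma> * b) / 2 - 3 / 2 * (a - \<sigma> * b)"
    "(a / 4 + 3 / 2 * of_real \<eta> * b) + \<sigma> * (3 / 2 * of_real \<eta> * a - 5 / 4 * b)
       = - (a + \<sigma> * b) / 2 - 3 / 2 * \<rho> (- \<sigma>) * (a - \<sigma> * b)"
    "(a / 4 - 3 / 2 * of_real \<eta> * b) + \<sigma> * (- 3 / 2 * of_real \<eta> * a - 5 / 4 * b)
       = - (a + \<sigma> * b) / 2 - 3 / 2 * \<rho> \<sigma> * (a - \<sigma> * b)"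
proof -
  show "- 2 * a + \<sigma> * b = - (a + \<sigma> * b) / 2 - 3 / 2 * (a - \<sigma> * b)" by (simp add: field_simps)
  show "(a / 4 + 3 / 2 * of_real \<eta> * b) + \<sigma> * (3 / 2 * of_real \<eta> * a - 5 / 4 * b)
       = - (a + \<sigma> * b) / 2 - 3 / 2 * \<rho> (- \<sigma>) * (a - \<sigma> * b)"
    "(a / 4 - 3 / 2 * of_real \<eta> * b) + \<sigma> * (- 3 / 2 * of_real \<eta> * a - 5 / 4 * b)
       = - (a + \<sigma> * b) / 2 - 3 / 2 * \<rho> \<sigma> * (a - \<sigma> * b)"
    unfolding \<rho>_def using s by algebra+
qed

lemma lin_planar:
  fixes h :: state
  defines "c \<equiv> of_real (h $ (Pi0, 3) / C0)"
  assumes s: "\<sigma> * \<sigma> = - 1"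
  shows "planar_lam \<sigma> (complexify (lin h)) = planar_vel_lam \<sigma> (complexify h) - \<sigma> * of_real \<omega> * planar_lam \<sigma> (complexify h) - \<sigma> * of_real Z * c"
    "planar_rel \<sigma> (complexify (lin h)) = planar_vel_rel \<sigma> (complexify h) - \<sigma> * of_real \<omega> * planar_rel \<sigma> (complexify h) - \<sigma> * of_real Z * \<rho> \<sigma> * c"
    "planar_vel_lam \<sigma> (complexify (lin h)) = - \<sigma> * of_real \<omega> * planar_vel_lam \<sigma> (complexify h) + of_real \<omega> * of_real Z * c
       + of_real \<kappa> * (of_real (m0 + m1 + m2) / 2 * planar_lam \<sigma> (complexify h)
          + 3 / 2 * ((of_real (m1 + m2) + of_real m0 * \<rho> \<sigma>) * planar_lam (- \<sigma>) (complexify h)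
             - of_real m0 * (\<rho> (- \<sigma>) - \<rho> \<sigma>) * planar_rel (- \<sigma>) (complexify h)))"
    "planar_vel_rel \<sigma> (complexify (lin h)) = - \<sigma> * of_real \<omega> * planar_vel_rel \<sigma> (complexify h) + of_real \<omega> * of_real Z * \<rho> \<sigma> * c
       + of_real \<kappa> * (of_real (m0 + m1 + m2) / 2 * planar_rel \<sigma> (complexify h)
          + 3 / 2 * ((of_real (m0 + m1) * \<rho> (- \<sigma>) + of_real m2 * \<rho> \<sigma>) * planar_rel (- \<sigma>) (complexify h)
             - of_real m2 * (1 - \<rho> \<sigma>) * planar_lam (- \<sigma>) (complexify h)))"
proof -
  have ss: "\<sigma> * (\<sigma> * x) = - x" for x using s by (metis mult.assoc mult_minus1)
  let ?a = "complex_of_real (h $ (Lam, 1))" and ?b = "complex_of_real (h $ (Lam, 2))"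
  let ?u = "complex_of_real (rel h 1)" and ?v = "complex_of_real (rel h 2)"
  show "planar_lam \<sigma> (complexify (lin h)) = planar_vel_lam \<sigma> (complexify h) - \<sigma> * of_real \<omega> * planar_lam \<sigma> (complexify h) - \<sigma> * of_real Z * c"
    unfolding planar_lam_def planar_vel_lam_def complexify_functionals complexify_nth lin_positions
    by (simp add: algebra_simps ss c_def)
  show "planar_rel \<sigma> (complexify (lin h)) = planar_vel_rel \<sigma> (complexify h) - \<sigma> * of_real \<omega> * planar_rel \<sigma> (complexify h) - \<sigma> * of_real Z * \<rho> \<sigma> * c"
    unfolding planar_rel_def planar_vel_rel_def complexify_functionals complexify_nth lin_rel \<rho>_def
    by (simp add: algebra_simps ss c_def)
  have k0: "- 2 * ?a + \<sigma> * ?b = - planar_lam \<sigma> (complexify h) / 2 - 3 / 2 * planar_lam (- \<sigma>) (complexify h)"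
    unfolding tidal_complex(1)[OF s] by (simp add: planar_lam_def complexify_nth)
  have k1: "(?u / 4 + 3 / 2 * of_real \<eta> * ?v) + \<sigma> * (3 / 2 * of_real \<eta> * ?u - 5 / 4 * ?v)
      = - planar_rel \<sigma> (complexify h) / 2 - 3 / 2 * \<rho> (- \<sigma>) * planar_rel (- \<sigma>) (complexify h)"
    unfolding tidal_complex(2)[OF s] by (simp add: planar_rel_def complexify_functionals)
  have k2: "((?u + ?a) / 4 - 3 / 2 * of_real \<eta> * (?v + ?b)) + \<sigma> * (- 3 / 2 * of_real \<eta> * (?u + ?a) - 5 / 4 * (?v + ?b))
      = - (planar_rel \<sigma> (complexify h) + planar_lam \<sigma> (complexify h)) / 2
        - 3 / 2 * \<rho> \<sigma> * (planar_rel (- \<sigma>) (complexify h) + planar_lam (- \<sigma>) (complexify h))"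
    unfolding tidal_complex(3)[OF s] by (simp add: planar_rel_def planar_lam_def complexify_functionals complexify_nth algebra_simps)
  have e: "of_real (m1 + m2) * (- planar_lam \<sigma> (complexify h) / 2 - 3 / 2 * planar_lam (- \<sigma>) (complexify h))
      - of_real m0 * (- planar_rel \<sigma> (complexify h) / 2 - 3 / 2 * \<rho> (- \<sigma>) * planar_rel (- \<sigma>) (complexify h))
      + of_real m0 * (- (planar_rel \<sigma> (complexify h) + planar_lam \<sigma> (complexify h)) / 2
          - 3 / 2 * \<rho> \<sigma> * (planar_rel (- \<sigma>) (complexify h) + planar_lam (- \<sigma>) (complexify h)))
    = - (of_real (m0 + m1 + m2) / 2 * planar_lam \<sigma> (complexify h)
          + 3 / 2 * ((of_real (m1 + m2) + of_real m0 * \<rho> \<sigma>) * planar_lam (- \<sigma>) (complexify h)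
             - of_real m0 * (\<rho> (- \<sigma>) - \<rho> \<sigma>) * planar_rel (- \<sigma>) (complexify h)))"
    by (simp add: field_simps)
  have "planar_vel_lam \<sigma> (complexify (lin h)) = - \<sigma> * of_real \<omega> * planar_vel_lam \<sigma> (complexify h) + of_real \<omega> * of_real Z * c
      - of_real \<kappa> * (of_real (m1 + m2) * (- 2 * ?a + \<sigma> * ?b)
        - of_real m0 * ((?u / 4 + 3 / 2 * of_real \<eta> * ?v) + \<sigma> * (3 / 2 * of_real \<eta> * ?u - 5 / 4 * ?v))
        + of_real m0 * (((?u + ?a) / 4 - 3 / 2 * of_real \<eta> * (?v + ?b)) + \<sigma> * (- 3 / 2 * of_real \<eta> * (?u + ?a) - 5 / 4 * (?v + ?b))))"
  proof -
    have "of_real (\<omega> * p2 + \<omega> * Z * (w / C0) - k * (S * x0 - m0 * x1 + m0 * x2))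
        + \<sigma> * of_real (- \<omega> * p1 - k * (S * y0 - m0 * y1 + m0 * y2))
      = - \<sigma> * of_real \<omega> * (of_real p1 + \<sigma> * of_real p2) + of_real \<omega> * of_real Z * of_real (w / C0)
        - of_real k * (of_real S * (of_real x0 + \<sigma> * of_real y0)
           - of_real m0 * (of_real x1 + \<sigma> * of_real y1) + of_real m0 * (of_real x2 + \<sigma> * of_real y2))"
      for p1 p2 w k S x0 x1 x2 y0 y1 y2 :: real
      by (simp add: algebra_simps ss)
    from this[of "vel_lam h 2" "h $ (Pi0, 3)" \<kappa> "m1 + m2" "- 2 * h $ (Lam, 1)"
        "rel h 1 / 4 + 3 / 2 * \<eta> * rel h 2" "(rel h 1 + h $ (Lam, 1)) / 4 - 3 / 2 * \<eta> * (rel h 2 + h $ (Lam, 2))"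
        "vel_lam h 1" "h $ (Lam, 2)" "3 / 2 * \<eta> * rel h 1 - 5 / 4 * rel h 2"
        "- 3 / 2 * \<eta> * (rel h 1 + h $ (Lam, 1)) - 5 / 4 * (rel h 2 + h $ (Lam, 2))"]
    show ?thesis unfolding planar_vel_lam_def complexify_functionals lin_vel_lam c_def
      by (simp only: of_real_add of_real_diff of_real_mult of_real_divide of_real_power of_real_minus
          of_real_numeral of_real_neg_numeral)
  qed
  then show "planar_vel_lam \<sigma> (complexify (lin h)) = - \<sigma> * of_real \<omega> * planar_vel_lam \<sigma> (complexify h) + of_real \<omega> * of_real Z * c
       + of_real \<kappa> * (of_real (m0 + m1 + m2) / 2 * planar_lam \<sigma> (complexify h)
          + 3 / 2 * ((of_real (m1 + m2) + of_real m0 * \<rho> \<sigma>) * planar_lam (- \<sigma>) (complexify h)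
             - of_real m0 * (\<rho> (- \<sigma>) - \<rho> \<sigma>) * planar_rel (- \<sigma>) (complexify h)))"
    unfolding k0 k1 k2 e by (simp only: mult_minus_right diff_minus_eq_add)
  have e: "of_real (m0 + m1) * (- planar_rel \<sigma> (complexify h) / 2 - 3 / 2 * \<rho> (- \<sigma>) * planar_rel (- \<sigma>) (complexify h))
      + of_real m2 * (- (planar_rel \<sigma> (complexify h) + planar_lam \<sigma> (complexify h)) / 2
          - 3 / 2 * \<rho> \<sigma> * (planar_rel (- \<sigma>) (complexify h) + planar_lam (- \<sigma>) (complexify h)))
      - of_real m2 * (- planar_lam \<sigma> (complexify h) / 2 - 3 / 2 * planar_lam (- \<sigma>) (complexify h))
    = - (of_real (m0 + m1 + m2) / 2 * planar_rel \<sigma> (complexify h)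
          + 3 / 2 * ((of_real (m0 + m1) * \<rho> (- \<sigma>) + of_real m2 * \<rho> \<sigma>) * planar_rel (- \<sigma>) (complexify h)
             - of_real m2 * (1 - \<rho> \<sigma>) * planar_lam (- \<sigma>) (complexify h)))"
    by (simp add: field_simps)
  have "planar_vel_rel \<sigma> (complexify (lin h)) = - \<sigma> * of_real \<omega> * planar_vel_rel \<sigma> (complexify h) + of_real \<omega> * of_real Z * \<rho> \<sigma> * c
      - of_real \<kappa> * (of_real (m0 + m1) * ((?u / 4 + 3 / 2 * of_real \<eta> * ?v) + \<sigma> * (3 / 2 * of_real \<eta> * ?u - 5 / 4 * ?v))
        + of_real m2 * (((?u + ?a) / 4 - 3 / 2 * of_real \<eta> * (?v + ?b)) + \<sigma> * (- 3 / 2 * of_real \<eta> * (?u + ?a) - 5 / 4 * (?v + ?b)))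
        - of_real m2 * (- 2 * ?a + \<sigma> * ?b))"
  proof -
    have "of_real (\<omega> * p2 - \<omega> * Z / 2 * (w / C0) - k * (S * x1 + m2 * x2 - m2 * x0))
        + \<sigma> * of_real (- \<omega> * p1 + \<omega> * \<eta> * Z * (w / C0) - k * (S * y1 + m2 * y2 - m2 * y0))
      = - \<sigma> * of_real \<omega> * (of_real p1 + \<sigma> * of_real p2) + of_real \<omega> * of_real Z * \<rho> \<sigma> * of_real (w / C0)
        - of_real k * (of_real S * (of_real x1 + \<sigma> * of_real y1)
           + of_real m2 * (of_real x2 + \<sigma> * of_real y2) - of_real m2 * (of_real x0 + \<sigma> * of_real y0))"
      for p1 p2 w k S x0 x1 x2 y0 y1 y2 :: real
      unfolding \<rho>_def by (simp add: algebra_simps ss)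
    from this[of "vel_rel h 2" "h $ (Pi0, 3)" \<kappa> "m0 + m1" "rel h 1 / 4 + 3 / 2 * \<eta> * rel h 2"
        "(rel h 1 + h $ (Lam, 1)) / 4 - 3 / 2 * \<eta> * (rel h 2 + h $ (Lam, 2))" "- 2 * h $ (Lam, 1)"
        "vel_rel h 1" "3 / 2 * \<eta> * rel h 1 - 5 / 4 * rel h 2"
        "- 3 / 2 * \<eta> * (rel h 1 + h $ (Lam, 1)) - 5 / 4 * (rel h 2 + h $ (Lam, 2))" "h $ (Lam, 2)"]
    show ?thesis unfolding planar_vel_rel_def complexify_functionals lin_vel_rel c_def
      by (simp only: of_real_add of_real_diff of_real_mult of_real_divide of_real_power of_real_minus
          of_real_numeral of_real_neg_numeral)
  qed
  then show "planar_vel_rel \<sigma> (complexify (lin h)) = - \<sigma> * of_real \<omega> * planar_vel_rel \<sigma> (complexify h) + of_real \<omega> * of_real Z * \<rho> \<sigma> * c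
       + of_real \<kappa> * (of_real (m0 + m1 + m2) / 2 * planar_rel \<sigma> (complexify h)
          + 3 / 2 * ((of_real (m0 + m1) * \<rho> (- \<sigma>) + of_real m2 * \<rho> \<sigma>) * planar_rel (- \<sigma>) (complexify h)
             - of_real m2 * (1 - \<rho> \<sigma>) * planar_lam (- \<sigma>) (complexify h)))"
    unfolding k0 k1 k2 e by (simp only: mult_minus_right diff_minus_eq_add)
qed

text \<open>Both sides of each identity for real states are complex linear, so they extend to complex states by
splitting these into real and imaginary parts.\<close>
lemma act_planar:
  fixes v defines "c \<equiv> v $ (Pi0, 3) / of_real C0"
  assumes s: "\<sigma> * \<sigma> = - 1"
  shows "planar_lam \<sigma> (act v) = planar_vel_lam \<sigma> v - \<sigma> * of_real \<omega> * planar_lam \<sigma> v - \<sigma> * of_real Z * c"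
    "planar_rel \<sigma> (act v) = planar_vel_rel \<sigma> v - \<sigma> * of_real \<omega> * planar_rel \<sigma> v - \<sigma> * of_real Z * \<rho> \<sigma> * c"
    "planar_vel_lam \<sigma> (act v) = - \<sigma> * of_real \<omega> * planar_vel_lam \<sigma> v + of_real \<omega> * of_real Z * c
       + of_real \<kappa> * (of_real (m0 + m1 + m2) / 2 * planar_lam \<sigma> v
          + 3 / 2 * ((of_real (m1 + m2) + of_real m0 * \<rho> \<sigma>) * planar_lam (- \<sigma>) v
             - of_real m0 * (\<rho> (- \<sigma>) - \<rho> \<sigma>) * planar_rel (- \<sigma>) v))"
    "planar_vel_rel \<sigma> (act v) = - \<sigma> * of_real \<omega> * planar_vel_rel \<sigma> v + of_real \<omega> * of_real Z * \<rho> \<sigma> * c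
       + of_real \<kappa> * (of_real (m0 + m1 + m2) / 2 * planar_rel \<sigma> v
          + 3 / 2 * ((of_real (m0 + m1) * \<rho> (- \<sigma>) + of_real m2 * \<rho> \<sigma>) * planar_rel (- \<sigma>) v
             - of_real m2 * (1 - \<rho> \<sigma>) * planar_lam (- \<sigma>) v))"
proof -
  let ?r = "\<chi> q. Re (v $ q)" and ?s = "\<chi> q. Im (v $ q)"
  have c: "c = of_real (?r $ (Pi0, 3) / C0) + \<i> * of_real (?s $ (Pi0, 3) / C0)"
    by (simp add: c_def complex_eq_iff)
  have f: "planar_lam \<tau> v = planar_lam \<tau> (complexify ?r) + \<i> * planar_lam \<tau> (complexify ?s)"
    "planar_rel \<tau> v = planar_rel \<tau> (complexify ?r) + \<i> * planar_rel \<tau> (complexify ?s)"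
    "planar_vel_lam \<tau> v = planar_vel_lam \<tau> (complexify ?r) + \<i> * planar_vel_lam \<tau> (complexify ?s)"
    "planar_vel_rel \<tau> v = planar_vel_rel \<tau> (complexify ?r) + \<i> * planar_vel_rel \<tau> (complexify ?s)" for \<tau>
    by (subst complex_state_split, rule planar_combination)+
  note * = act_split planar_combination lin_planar[OF s] c f
  show "planar_lam \<sigma> (act v) = planar_vel_lam \<sigma> v - \<sigma> * of_real \<omega> * planar_lam \<sigma> v - \<sigma> * of_real Z * c"
    unfolding * by algebra
  show "planar_rel \<sigma> (act v) = planar_vel_rel \<sigma> v - \<sigma> * of_real \<omega> * planar_rel \<sigma> v - \<sigma> * of_real Z * \<rho> \<sigma> * c"
    unfolding * by algebra
  show "planar_vel_lam \<sigma> (act v) = - \<sigma> * of_real \<omega> * planar_vel_lam \<sigma> v + of_real \<omega> * of_real Z * c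
       + of_real \<kappa> * (of_real (m0 + m1 + m2) / 2 * planar_lam \<sigma> v
          + 3 / 2 * ((of_real (m1 + m2) + of_real m0 * \<rho> \<sigma>) * planar_lam (- \<sigma>) v
             - of_real m0 * (\<rho> (- \<sigma>) - \<rho> \<sigma>) * planar_rel (- \<sigma>) v))"
    unfolding * by algebra
  show "planar_vel_rel \<sigma> (act v) = - \<sigma> * of_real \<omega> * planar_vel_rel \<sigma> v + of_real \<omega> * of_real Z * \<rho> \<sigma> * c
       + of_real \<kappa> * (of_real (m0 + m1 + m2) / 2 * planar_rel \<sigma> v
          + 3 / 2 * ((of_real (m0 + m1) * \<rho> (- \<sigma>) + of_real m2 * \<rho> \<sigma>) * planar_rel (- \<sigma>) v
             - of_real m2 * (1 - \<rho> \<sigma>) * planar_lam (- \<sigma>) v))"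
    unfolding * by algebra
qed

end

section \<open>The shape-changing mode\<close>

context equilateral_configuration
begin

text \<open>If the sides \<open>Z\<close> and \<open>Z \<rho>\<close> are displaced by \<open>Z (a + b)\<close> and \<open>Z \<rho> (a + b \<rho>)\<close>, then \<open>mode\<close> is
\<open>Z b (\<rho> - \<rho>\<^sup>2)\<close>. It vanishes exactly if the triangle stays equilateral to first order.\<close>
definition "mode \<sigma> v = \<rho> \<sigma> * planar_lam \<sigma> v - planar_rel \<sigma> v"
definition "mode_vel \<sigma> v = \<rho> \<sigma> * planar_vel_lam \<sigma> v - planar_vel_rel \<sigma> v"
definition "\<nu> \<sigma> = \<rho> \<sigma> * (of_real m2 + of_real m1 * \<rho> \<sigma> + of_real m0 * \<rho> (- \<sigma>))"

lemma \<rho>_reduce: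
  assumes "\<sigma> * \<sigma> = - 1"
  shows "\<rho> (- \<sigma>) = - 1 - \<rho> \<sigma>" "\<rho> \<sigma> * \<rho> \<sigma> = - 1 - \<rho> \<sigma>"
    "\<rho> \<sigma> * (\<rho> \<sigma> * z) = - z - \<rho> \<sigma> * z"
proof -
  show 1: "\<rho> (- \<sigma>) = - 1 - \<rho> \<sigma>" by (simp add: \<rho>_def)
  show 2: "\<rho> \<sigma> * \<rho> \<sigma> = - 1 - \<rho> \<sigma>" unfolding \<rho>_square[OF assms] by (rule 1)
  show "\<rho> \<sigma> * (\<rho> \<sigma> * z) = - z - \<rho> \<sigma> * z"
    unfolding mult.assoc[symmetric] 2 by (simp add: algebra_simps)
qed

text \<open>The equations of \<open>mode\<close> are closed: the change of the angular velocity of the frame and the similarity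
component \<open>a\<close> drop out, and the tidal terms collect into a single coefficient \<open>\<nu>\<close>.\<close>
lemma act_mode:
  assumes s: "\<sigma> * \<sigma> = - 1"
  shows "mode \<sigma> (act v) = mode_vel \<sigma> v - \<sigma> * of_real \<omega> * mode \<sigma> v"
    "mode_vel \<sigma> (act v) = - \<sigma> * of_real \<omega> * mode_vel \<sigma> v
       + of_real \<kappa> * (of_real (m0 + m1 + m2) / 2 * mode \<sigma> v + 3 / 2 * \<nu> \<sigma> * mode (- \<sigma>) v)"
proof -
  show "mode \<sigma> (act v) = mode_vel \<sigma> v - \<sigma> * of_real \<omega> * mode \<sigma> v"
    unfolding mode_def mode_vel_def act_planar[OF s] by (simp add: algebra_simps)
  define r r' where r: "r = \<rho> \<sigma>" "r' = \<rho> (- \<sigma>)"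
  have ring: "r * (q * x + d * ((S + n0 * r) * x' - n0 * (r' - r) * y'))
      - (q * y + d * ((T * r' + n2 * r) * y' - n2 * (1 - r) * x'))
    = q * (r * x - y) + d * (r * (n2 + n1 * r + n0 * r')) * (r' * x' - y')"
    if "S = n1 + n2" "T = n0 + n1" for q x x' y y' S T n0 n1 n2 d :: complex
    using that unfolding r by (simp add: algebra_simps \<rho>_reduce[OF s])
  have split: "r * (- \<sigma> * w * a + w * t + k * X) - (- \<sigma> * w * b + w * u + k * Y)
      = - \<sigma> * w * (r * a - b) + k * (r * X - Y)" if "r * t = u" for a b k w t u X Y :: complex
    unfolding that[symmetric] by (simp add: algebra_simps)
  show "mode_vel \<sigma> (act v) = - \<sigma> * of_real \<omega> * mode_vel \<sigma> v
       + of_real \<kappa> * (of_real (m0 + m1 + m2) / 2 * mode \<sigma> v + 3 / 2 * \<nu> \<sigma> * mode (- \<sigma>) v)"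
    unfolding mode_def mode_vel_def \<nu>_def act_planar[OF s] r[symmetric] minus_minus mult.assoc[of "of_real \<omega>"]
    unfolding mult.assoc[of "of_real Z" r] split[OF mult.left_commute] ring[OF of_real_add of_real_add] ..
qed

definition "mass_products = m1 * m0 + m2 * m0 + m1 * m2"

definition "mode_polynomial c = c ^ 4 + of_real (\<omega>\<^sup>2) * c\<^sup>2 + of_real (27 / 4 * \<kappa>\<^sup>2 * mass_products)" for c :: complex

lemma \<nu>_product:
  assumes s: "\<sigma> * \<sigma> = - 1"
  shows "\<nu> \<sigma> * \<nu> (- \<sigma>) = of_real ((m0 + m1 + m2)\<^sup>2 - 3 * mass_products)"
proof -
  have "r * (n2 + n1 * r + n0 * r') * (r' * (n2 + n1 * r' + n0 * r)) =
      (n0 + n1 + n2)\<^sup>2 - 3 * (n1 * n0 + n2 * n0 + n1 * n2)" if r: "r = \<rho> \<sigma>" "r' = \<rho> (- \<sigma>)" for n0 n1 n2 r r' :: complex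
    unfolding r by (simp add: algebra_simps power2_eq_square \<rho>_reduce[OF s])
  from this[OF refl refl] show ?thesis unfolding \<nu>_def minus_minus mass_products_def by simp
qed

lemma kappa_distrib:
  "of_real \<kappa> * (of_real (m0 + m1 + m2) / 2 * x + y) = of_real (\<omega>\<^sup>2) / 2 * x + of_real \<kappa> * y" for x y :: complex
proof -
  have "k * (M / 2 * x + y) = (k * M) / 2 * x + k * y" for k M :: complex by (simp add: distrib_left)
  then show ?thesis unfolding kappa[symmetric] of_real_mult .
qed

text \<open>The determinant of the system for \<open>mode\<close> and its conjugate after elimination of the velocities. The
constant term of the quartic arises as \<open>(9/4) \<kappa>\<^sup>2 ((m\<^sub>0 + m\<^sub>1 + m\<^sub>2)\<^sup>2 - \<nu> \<nu>')\<close>.\<close>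
lemma mode_determinant:
  assumes s: "\<sigma> * \<sigma> = - 1"
  shows "((c + \<sigma> * of_real \<omega>)\<^sup>2 - of_real (\<omega>\<^sup>2) / 2) * ((c - \<sigma> * of_real \<omega>)\<^sup>2 - of_real (\<omega>\<^sup>2) / 2)
     = mode_polynomial c + (3 / 2 * of_real \<kappa> * \<nu> \<sigma>) * (3 / 2 * of_real \<kappa> * \<nu> (- \<sigma>))"
proof -
  define k M P w where "k = complex_of_real \<kappa>" and "M = complex_of_real (m0 + m1 + m2)"
    and "P = complex_of_real mass_products" and "w = complex_of_real \<omega>"
  have w: "w * w = k * M"
    unfolding k_def M_def w_def of_real_mult[symmetric] kappa power2_eq_square ..
  have "(3 / 2 * k * \<nu> \<sigma>) * (3 / 2 * k * \<nu> (- \<sigma>)) = 9 / 4 * (k * k) * (\<nu> \<sigma> * \<nu> (- \<sigma>))" by simp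
  also have "\<dots> = 9 / 4 * (k * k) * (M\<^sup>2 - 3 * P)"
    unfolding \<nu>_product[OF s] M_def P_def by simp
  finally have n: "(3 / 2 * k * \<nu> \<sigma>) * (3 / 2 * k * \<nu> (- \<sigma>)) = 9 / 4 * (w * w * (w * w)) - 27 / 4 * (k * k) * P"
    unfolding w by (simp add: algebra_simps power2_eq_square)
  have "((c + \<sigma> * w)\<^sup>2 - w\<^sup>2 / 2) * ((c - \<sigma> * w)\<^sup>2 - w\<^sup>2 / 2) = c ^ 4 + w\<^sup>2 * c\<^sup>2 + 9 / 4 * (w * w * (w * w))"
  proof -
    have "(2 * (c + \<sigma> * w)\<^sup>2 - w\<^sup>2) * (2 * (c - \<sigma> * w)\<^sup>2 - w\<^sup>2) = 4 * c ^ 4 + 4 * w\<^sup>2 * c\<^sup>2 + 9 * (w * w * (w * w))"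
      using s by algebra
    then show ?thesis by (simp add: field_simps)
  qed
  then show ?thesis
    unfolding n[unfolded k_def] mode_polynomial_def
    by (simp add: w_def k_def P_def power2_eq_square)
qed

lemma conjugate_coordinates_zero:
  fixes x y \<sigma> :: complex
  assumes "\<sigma> * \<sigma> = - 1" "x + \<sigma> * y = 0" "x - \<sigma> * y = 0"
  shows "x = 0 \<and> y = 0"
proof -
  have "\<sigma> \<noteq> 0" using assms(1) by auto
  moreover have "2 * x = 0" "2 * (\<sigma> * y) = 0" using assms(2,3) by algebra+
  ultimately show ?thesis by auto
qed

lemma square_plus_square_nonzero:
  assumes "Re c \<noteq> 0"
  shows "c\<^sup>2 + of_real (r\<^sup>2) \<noteq> 0"
proof
  assume "c\<^sup>2 + of_real (r\<^sup>2) = 0"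
  then have "(c + \<i> * of_real r) * (c - \<i> * of_real r) = 0"
    by (simp add: algebra_simps power2_eq_square)
  then have "c = - (\<i> * of_real r) \<or> c = \<i> * of_real r" by (auto simp: add_eq_0_iff2)
  with assms show False by auto
qed

lemma two_by_two_zero:
  fixes p q r s x y :: complex
  assumes "p * x = r * y" "q * y = s * x" "p * q - r * s \<noteq> 0"
  shows "x = 0 \<and> y = 0"
proof -
  have "(p * q - r * s) * x = 0" "(p * q - r * s) * y = 0" using assms(1,2) by algebra+
  with assms(3) show ?thesis by simp
qed

text \<open>For an eigenvalue off the imaginary axis that is not a root of the quartic, every component of the
eigenvector is shown to vanish: the momenta of the bodies and the vertical components because their own
eigenvalues are imaginary, the shape
component by the determinant, and the remaining similarity component by that of the Kepler problem,
which is \<open>c\<^sup>2 (c\<^sup>2 + \<omega>\<^sup>2)\<close>.\<close>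
lemma eigenvalue_dichotomy:
  assumes ev: "eigenvalue (map_matrix complex_of_real (jacobian field ze)) c"
  shows "Re c = 0 \<or> mode_polynomial c = 0"
proof (rule ccontr)
  assume "\<not> ?thesis"
  then have Re: "Re c \<noteq> 0" and char: "mode_polynomial c \<noteq> 0" by auto
  then have c0: "c \<noteq> 0" by auto
  obtain v where v0: "v \<noteq> 0" and v: "act v = c *s v" using ev by (auto simp: eigenvalue_def act_def)
  have nth: "act v $ q = c * v $ q" for q by (simp add: v)
  have scaled: "rel (c *s v) i = c * rel v i" "vel_lam (c *s v) i = c * vel_lam v i"
    "vel_rel (c *s v) i = c * vel_rel v i" for i
    using functional_combination[of 0 c v i] by (simp_all add: rel_def vel_lam_def vel_rel_def)
  have planar_scaled: "planar_lam \<sigma> (c *s v) = c * planar_lam \<sigma> v" "planar_rel \<sigma> (c *s v) = c * planar_rel \<sigma> v"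
    "planar_vel_lam \<sigma> (c *s v) = c * planar_vel_lam \<sigma> v" "planar_vel_rel \<sigma> (c *s v) = c * planar_vel_rel \<sigma> v" for \<sigma>
    by (simp_all add: planar_lam_def planar_rel_def planar_vel_lam_def planar_vel_rel_def scaled algebra_simps)
  have mode_scaled: "mode \<sigma> (c *s v) = c * mode \<sigma> v" "mode_vel \<sigma> (c *s v) = c * mode_vel \<sigma> v" for \<sigma>
    by (simp_all add: mode_def mode_vel_def planar_scaled algebra_simps)
  define \<tau> where "\<tau> = \<omega> - (C0 * \<omega> + l) / A0"
  have rigid: "v $ (Pi1, i) = 0" "v $ (Pi2, i) = 0" for i
    using act_spin(1,2)[of v i] c0 unfolding nth by simp_all
  have gyro: "v $ (Pi0, i) = 0" for i
  proof -
    have e: "c * v $ (Pi0, 1) = of_real \<tau> * v $ (Pi0, 2)" "c * v $ (Pi0, 2) = - of_real \<tau> * v $ (Pi0, 1)"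
      using act_spin(3,4)[of v, folded \<tau>_def] unfolding nth by simp_all
    have "c * c - of_real \<tau> * (- of_real \<tau>) \<noteq> 0"
      using square_plus_square_nonzero[OF Re, of \<tau>] by (simp add: power2_eq_square)
    from two_by_two_zero[OF e this] have "v $ (Pi0, 1) = 0 \<and> v $ (Pi0, 2) = 0" .
    moreover have "v $ (Pi0, 3) = 0" using act_spin(5)[of v] c0 unfolding nth by simp
    ultimately show ?thesis using exhaust_3[of i] by metis
  qed
  have vert: "v $ (Lam, 3) = 0" "vel_lam v 3 = 0" "rel v 3 = 0" "vel_rel v 3 = 0"
  proof -
    note w = act_vertical[OF gyro, unfolded nth, unfolded v scaled]
    have nz: "c * c - 1 * (- of_real (\<omega>\<^sup>2)) \<noteq> 0"
      using square_plus_square_nonzero[OF Re, of \<omega>] by (simp add: power2_eq_square)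
    show "v $ (Lam, 3) = 0" "vel_lam v 3 = 0"
      using two_by_two_zero[of c _ 1, OF _ w(2) nz] w(1) by simp_all
    show "rel v 3 = 0" "vel_rel v 3 = 0"
      using two_by_two_zero[of c _ 1, OF _ w(4) nz] w(3) by simp_all
  qed
  let ?w = "complex_of_real \<omega>"
  have modes: "mode \<i> v = 0 \<and> mode (- \<i>) v = 0"
  proof -
    have eq: "((c + \<sigma> * ?w)\<^sup>2 - of_real (\<omega>\<^sup>2) / 2) * mode \<sigma> v = (3 / 2 * of_real \<kappa> * \<nu> \<sigma>) * mode (- \<sigma>) v"
      if s: "\<sigma> * \<sigma> = - 1" for \<sigma>
    proof -
      note a = act_mode[OF s, of v, unfolded v mode_scaled, unfolded kappa_distrib]
      have "mode_vel \<sigma> v = (c + \<sigma> * ?w) * mode \<sigma> v" using a(1) by (simp add: algebra_simps)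
      with a(2) show ?thesis by (simp add: power2_eq_square algebra_simps)
    qed
    show ?thesis
    proof (rule two_by_two_zero)
      show "((c + \<i> * ?w)\<^sup>2 - of_real (\<omega>\<^sup>2) / 2) * mode \<i> v = (3 / 2 * of_real \<kappa> * \<nu> \<i>) * mode (- \<i>) v"
        using eq[of \<i>] by simp
      show "((c - \<i> * ?w)\<^sup>2 - of_real (\<omega>\<^sup>2) / 2) * mode (- \<i>) v = (3 / 2 * of_real \<kappa> * \<nu> (- \<i>)) * mode \<i> v"
        using eq[of "- \<i>"] by simp
      show "((c + \<i> * ?w)\<^sup>2 - of_real (\<omega>\<^sup>2) / 2) * ((c - \<i> * ?w)\<^sup>2 - of_real (\<omega>\<^sup>2) / 2)
          - (3 / 2 * of_real \<kappa> * \<nu> \<i>) * (3 / 2 * of_real \<kappa> * \<nu> (- \<i>)) \<noteq> 0"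
        using mode_determinant[of \<i> c] char by simp
    qed
  qed
  (* To first order the triangle now stays equilateral, so its sides are determined by \<lambda>,
     which obeys the linearized Kepler problem (radial). *)
  have rel_lam: "planar_rel \<sigma> v = \<rho> \<sigma> * planar_lam \<sigma> v" if "\<sigma> = \<i> \<or> \<sigma> = - \<i>" for \<sigma>
    using modes that by (auto simp: mode_def)
  have lam_vel: "planar_vel_lam \<sigma> v = (c + \<sigma> * ?w) * planar_lam \<sigma> v"
    and rel_vel: "planar_vel_rel \<sigma> v = (c + \<sigma> * ?w) * planar_rel \<sigma> v" if "\<sigma> = \<i> \<or> \<sigma> = - \<i>" for \<sigma>
  proof -
    have s: "\<sigma> * \<sigma> = - 1" using that by auto
    show "planar_vel_lam \<sigma> v = (c + \<sigma> * ?w) * planar_lam \<sigma> v" "planar_vel_rel \<sigma> v = (c + \<sigma> * ?w) * planar_rel \<sigma> v"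
      using act_planar(1,2)[OF s, of v] unfolding v planar_scaled gyro by (simp_all add: algebra_simps)
  qed
  have radial: "((c + \<sigma> * ?w)\<^sup>2 - of_real (\<omega>\<^sup>2) / 2) * planar_lam \<sigma> v = (3 / 2 * of_real (\<omega>\<^sup>2)) * planar_lam (- \<sigma>) v"
    if sg: "\<sigma> = \<i> \<or> \<sigma> = - \<i>" for \<sigma>
  proof -
    have s: "\<sigma> * \<sigma> = - 1" and sg': "- \<sigma> = \<i> \<or> - \<sigma> = - \<i>" using sg by auto
    have ring: "(S + n0 * \<rho> \<sigma>) * x - n0 * (\<rho> (- \<sigma>) - \<rho> \<sigma>) * (\<rho> (- \<sigma>) * x) = (n0 + S) * x" for S n0 x :: complex
      by (simp add: algebra_simps \<rho>_reduce[OF s])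
    have A: "c * planar_vel_lam \<sigma> v = - \<sigma> * ?w * planar_vel_lam \<sigma> v
      + of_real \<kappa> * (of_real (m0 + m1 + m2) / 2 * planar_lam \<sigma> v + 3 / 2 * (of_real (m0 + m1 + m2) * planar_lam (- \<sigma>) v))"
      using act_planar(3)[OF s, of v] unfolding v planar_scaled gyro rel_lam[OF sg'] ring
      by (simp add: add.assoc)
    have k3: "of_real \<kappa> * (3 / 2 * (of_real (m0 + m1 + m2) * y)) = 3 / 2 * of_real (\<omega>\<^sup>2) * y" for y :: complex
      unfolding kappa[symmetric] of_real_mult by (simp only: mult_ac)
    from A[unfolded kappa_distrib k3] show ?thesis unfolding lam_vel[OF sg] by (simp add: power2_eq_square algebra_simps)
  qed
  have lam0: "planar_lam \<i> v = 0 \<and> planar_lam (- \<i>) v = 0"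
  proof (rule two_by_two_zero)
    show "((c + \<i> * ?w)\<^sup>2 - of_real (\<omega>\<^sup>2) / 2) * planar_lam \<i> v = (3 / 2 * of_real (\<omega>\<^sup>2)) * planar_lam (- \<i>) v"
      using radial[of \<i>] by simp
    show "((c - \<i> * ?w)\<^sup>2 - of_real (\<omega>\<^sup>2) / 2) * planar_lam (- \<i>) v = (3 / 2 * of_real (\<omega>\<^sup>2)) * planar_lam \<i> v"
      using radial[of "- \<i>"] by simp
    have "((c + \<i> * w)\<^sup>2 - w\<^sup>2 / 2) * ((c - \<i> * w)\<^sup>2 - w\<^sup>2 / 2) - (3 / 2 * w\<^sup>2) * (3 / 2 * w\<^sup>2) = c\<^sup>2 * (c\<^sup>2 + w\<^sup>2)" for w
    proof -
      have "\<i> * \<i> = - 1" by simp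
      then have "(2 * (c + \<i> * w)\<^sup>2 - w\<^sup>2) * (2 * (c - \<i> * w)\<^sup>2 - w\<^sup>2) - (3 * w\<^sup>2) * (3 * w\<^sup>2) = 4 * (c\<^sup>2 * (c\<^sup>2 + w\<^sup>2))"
        by algebra
      then show ?thesis by (simp add: field_simps)
    qed
    from this[of ?w] show "((c + \<i> * ?w)\<^sup>2 - of_real (\<omega>\<^sup>2) / 2) * ((c - \<i> * ?w)\<^sup>2 - of_real (\<omega>\<^sup>2) / 2)
        - (3 / 2 * of_real (\<omega>\<^sup>2)) * (3 / 2 * of_real (\<omega>\<^sup>2)) \<noteq> 0"
      using c0 square_plus_square_nonzero[OF Re, of \<omega>] by simp
  qed
  have i: "\<i> = \<i> \<or> \<i> = - \<i>" "- \<i> = \<i> \<or> - \<i> = - \<i>" by auto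
  have planar: "v $ (Lam, 1) = 0 \<and> v $ (Lam, 2) = 0" "rel v 1 = 0 \<and> rel v 2 = 0"
    "vel_lam v 1 = 0 \<and> vel_lam v 2 = 0" "vel_rel v 1 = 0 \<and> vel_rel v 2 = 0"
  proof -
    have z: "planar_lam \<sigma> v = 0" "planar_rel \<sigma> v = 0" "planar_vel_lam \<sigma> v = 0" "planar_vel_rel \<sigma> v = 0"
      if sg: "\<sigma> = \<i> \<or> \<sigma> = - \<i>" for \<sigma>
    proof -
      show l: "planar_lam \<sigma> v = 0" using lam0 sg by auto
      then show "planar_rel \<sigma> v = 0" "planar_vel_lam \<sigma> v = 0" "planar_vel_rel \<sigma> v = 0"
        using rel_lam[OF sg] lam_vel[OF sg] rel_vel[OF sg] by simp_all
    qed
    have ii: "\<i> * \<i> = - 1" by simp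
    note d = planar_lam_def planar_rel_def planar_vel_lam_def planar_vel_rel_def mult_minus_left add_uminus_conv_diff
    note z = z[OF i(1), unfolded d] z[OF i(2), unfolded d]
    show "v $ (Lam, 1) = 0 \<and> v $ (Lam, 2) = 0" by (rule conjugate_coordinates_zero[OF ii z(1,5)])
    show "rel v 1 = 0 \<and> rel v 2 = 0" by (rule conjugate_coordinates_zero[OF ii z(2,6)])
    show "vel_lam v 1 = 0 \<and> vel_lam v 2 = 0" by (rule conjugate_coordinates_zero[OF ii z(3,7)])
    show "vel_rel v 1 = 0 \<and> vel_rel v 2 = 0" by (rule conjugate_coordinates_zero[OF ii z(4,8)])
  qed
  have all: "v $ (Lam, i) = 0" "rel v i = 0" "vel_lam v i = 0" "vel_rel v i = 0" for i
    using planar vert exhaust_3[of i] by metis+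
  have g: "m1 * m2 / (m1 + m2) \<noteq> 0" "m0 * (m1 + m2) / (m0 + m1 + m2) \<noteq> 0"
    using pos masses by auto
  have "v $ (PLam, i) = 0" "v $ (Mu, i) = 0" "v $ (PMu, i) = 0" for i
  proof -
    show PL: "v $ (PLam, i) = 0" using all(3)[of i] g(1) unfolding vel_lam_def by (metis divide_eq_0_iff of_real_eq_0_iff)
    show "v $ (Mu, i) = 0" using all(1,2)[of i] by (simp add: rel_def)
    have "v $ (PMu, i) / of_real (m0 * (m1 + m2) / (m0 + m1 + m2)) = 0"
      using all(3,4)[of i] by (simp add: vel_rel_def)
    then show "v $ (PMu, i) = 0" using g(2) by (metis divide_eq_0_iff of_real_eq_0_iff)
  qed
  then have "v $ (k, i) = 0" for k i
    using rigid gyro all by (cases k) auto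
  then have "v = 0" by (simp add: vec_eq_iff split_paired_All)
  with v0 show False ..
qed

end

section \<open>Roots of the quartic and stability\<close>

lemma two_by_two_kernel:
  fixes p q r s :: complex
  assumes "p * q = r * s"
  obtains x y where "x \<noteq> 0 \<or> y \<noteq> 0" "p * x = r * y" "q * y = s * x"
proof (cases "p = 0 \<and> r = 0")
  case False
  show ?thesis by (rule that[of r p]) (use assms False in \<open>auto simp: mult_ac\<close>)
next
  case pr: True
  show ?thesis
  proof (cases "q = 0 \<and> s = 0")
    case True
    show ?thesis by (rule that[of 1 1]) (use pr True in auto)
  next
    case False
    show ?thesis by (rule that[of q s]) (use pr False in \<open>auto simp: mult_ac\<close>)
  qed
qed

context equilateral_configuration
begin

lemma mode_combination:
  "mode \<sigma> (u + c *s v) = mode \<sigma> u + c * mode \<sigma> v"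
  "mode_vel \<sigma> (u + c *s v) = mode_vel \<sigma> u + c * mode_vel \<sigma> v"
  by (simp_all add: mode_def mode_vel_def planar_combination algebra_simps)

text \<open>A root makes the system for \<open>mode\<close> singular. A kernel vector \<open>(x, y)\<close> of the transposed system gives
the left eigenvector \<open>u\<close>, which is simpler to write down than a right eigenvector, since the latter
also has a similarity component. That \<open>u\<close> is not zero is seen on states in which only the momentum of
\<open>\<mu>\<close> is nonzero.\<close>
lemma mode_root_imp_eigenvalue:
  assumes "mode_polynomial c = 0"
  shows "eigenvalue (map_matrix complex_of_real (jacobian field ze)) c"
proof -
  let ?w = "complex_of_real \<omega>"
  (* (x, y) is the kernel vector of the transposed system: compared with the eigenvalue equations,
     \<nu> \<i> and \<nu> (- \<i>) are interchanged. *)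
  obtain x y where xy: "x \<noteq> 0 \<or> y \<noteq> 0"
    and x: "((c + \<i> * ?w)\<^sup>2 - of_real (\<omega>\<^sup>2) / 2) * x = (3 / 2 * of_real \<kappa> * \<nu> (- \<i>)) * y"
    and y: "((c - \<i> * ?w)\<^sup>2 - of_real (\<omega>\<^sup>2) / 2) * y = (3 / 2 * of_real \<kappa> * \<nu> \<i>) * x"
    by (rule two_by_two_kernel[of "(c + \<i> * ?w)\<^sup>2 - of_real (\<omega>\<^sup>2) / 2" "(c - \<i> * ?w)\<^sup>2 - of_real (\<omega>\<^sup>2) / 2"
        "3 / 2 * of_real \<kappa> * \<nu> (- \<i>)" "3 / 2 * of_real \<kappa> * \<nu> \<i>"])
      (use mode_determinant[of \<i> c] assms in simp)
  define u where "u v = (c + \<i> * ?w) * x * mode \<i> v + (c - \<i> * ?w) * y * mode (- \<i>) v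
    + x * mode_vel \<i> v + y * mode_vel (- \<i>) v" for v
  have left: "u (act v) = c * u v" for v
  proof -
    have ii: "\<i> * \<i> = - 1" "- \<i> * - \<i> = - 1" by simp_all
    note a = act_mode[OF ii(1), of v, unfolded kappa_distrib] act_mode[OF ii(2), of v, unfolded kappa_distrib minus_minus]
    have "(c + i * w) * x * (b - i * w * a)
      + (c - i * w) * y * (b' - - i * w * a') + x * (- i * w * b + (W * a + k * (h * n * a'))) + y * (i * w * b' + (W * a' + k * (h * n' * a)))
      = c * ((c + i * w) * x * a + (c - i * w) * y * a' + x * b + y * b')"
      if e: "((c + i * w)\<^sup>2 - W) * x = (h * k * n') * y" "((c - i * w)\<^sup>2 - W) * y = (h * k * n) * x"
      for i w b a W k h n n' a' b' :: complex
    proof -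
      have "(c + i * w) * x * (b - i * w * a)
      + (c - i * w) * y * (b' - - i * w * a') + x * (- i * w * b + (W * a + k * (h * n * a'))) + y * (i * w * b' + (W * a' + k * (h * n' * a)))
      - c * ((c + i * w) * x * a + (c - i * w) * y * a' + x * b + y * b')
      = - a * (((c + i * w)\<^sup>2 - W) * x - (h * k * n') * y) - a' * (((c - i * w)\<^sup>2 - W) * y - (h * k * n) * x)"
        by (simp add: power2_eq_square algebra_simps)
      then show ?thesis by (simp add: e)
    qed
    from this[OF x y] show ?thesis unfolding u_def a .
  qed
  have u_comb: "u (v + r *s v') = u v + r * u v'" for v v' r
    unfolding u_def mode_combination by (simp add: algebra_simps)
  define g where "g = m0 * (m1 + m2) / (m0 + m1 + m2)"
  have g: "g \<noteq> 0" using pos(2) masses by (simp add: g_def)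
  define T where "T t = (axis (PMu, 1) 1 + t *s axis (PMu, 2) 1 :: complex ^ (block \<times> 3))" for t
  have T: "u (T t) = - (x * (1 + \<i> * t) + y * (1 - \<i> * t)) / of_real g" for t
    unfolding u_def mode_def mode_vel_def planar_lam_def planar_rel_def planar_vel_lam_def planar_vel_rel_def rel_def
      vel_rel_def vel_lam_def g_def[symmetric] T_def
    using g by (simp add: axis_def field_simps)
  have "\<exists>t. u (T t) \<noteq> 0"
  proof (cases "x = 0")
    case True
    then have "u (T \<i>) \<noteq> 0" using xy g unfolding T by simp
    then show ?thesis ..
  next
    case False
    then have "u (T (- \<i>)) \<noteq> 0" using g unfolding T by simp
    then show ?thesis ..
  qed
  then obtain t where t: "u (T t) \<noteq> 0" ..
  show ?thesis
  proof (rule not_surj_imp_eigenvalue[of _ _ "T t"])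
    fix v
    have "u (act v + (- c) *s v) = 0" unfolding u_comb left by simp
    moreover have "act v + (- c) *s v = act v - c *s v" by (simp add: vec_eq_iff)
    ultimately show "map_matrix complex_of_real (jacobian field ze) *v v - c *s v \<noteq> T t"
      using t unfolding act_def by metis
  qed
qed

lemma kappa_pos: "\<kappa> > 0" and mass_products_pos: "mass_products > 0"
  using pos by (simp_all add: mass_products_def add_pos_pos)

lemma omega4: "(\<omega>\<^sup>2)\<^sup>2 = \<kappa>\<^sup>2 * (m0 + m1 + m2)\<^sup>2"
  unfolding kappa[symmetric] by (rule power_mult_distrib)

lemma char_discriminant:
  "(2 * c\<^sup>2 + of_real (\<omega>\<^sup>2))\<^sup>2 = 4 * mode_polynomial c + of_real (\<kappa>\<^sup>2 * ((m0 + m1 + m2)\<^sup>2 - 27 * mass_products))"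
proof -
  define W K where "W = complex_of_real (\<omega>\<^sup>2)" and "K = complex_of_real (\<kappa>\<^sup>2 * mass_products)"
  have "complex_of_real (\<kappa>\<^sup>2 * ((m0 + m1 + m2)\<^sup>2 - 27 * mass_products)) = W\<^sup>2 - 27 * K"
    unfolding W_def K_def right_diff_distrib omega4[symmetric] by simp
  moreover have "mode_polynomial c = c ^ 4 + W * c\<^sup>2 + 27 / 4 * K"
    unfolding mode_polynomial_def W_def K_def by simp
  moreover have "(2 * c\<^sup>2 + W)\<^sup>2 = 4 * (c ^ 4 + W * c\<^sup>2 + 27 / 4 * K) + (W\<^sup>2 - 27 * K)"
    by (simp add: power2_eq_square power4_eq_xxxx algebra_simps)
  ultimately show ?thesis unfolding W_def[symmetric] by (simp only:)
qed

text \<open>The bound \<open>\<surd>D < \<omega>\<^sup>2\<close> says that the constant term of the quartic is positive; it makes both values of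
\<open>c\<^sup>2\<close> negative, also in the limiting case \<open>D = 0\<close>.\<close>
lemma mode_root_imaginary:
  assumes M: "(m0 + m1 + m2)\<^sup>2 \<ge> 27 * mass_products" and c: "mode_polynomial c = 0"
  shows "Re c = 0"
proof (rule ccontr)
  assume Re: "Re c \<noteq> 0"
  define D where "D = \<kappa>\<^sup>2 * ((m0 + m1 + m2)\<^sup>2 - 27 * mass_products)"
  have D: "D \<ge> 0" using M by (simp add: D_def)
  have "(2 * c\<^sup>2 + of_real (\<omega>\<^sup>2))\<^sup>2 = (of_real (sqrt D))\<^sup>2"
    using char_discriminant[of c, folded D_def] c D by (simp flip: of_real_power)
  then have "2 * c\<^sup>2 + of_real (\<omega>\<^sup>2) = of_real (sqrt D) \<or> 2 * c\<^sup>2 + of_real (\<omega>\<^sup>2) = - of_real (sqrt D)"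
    by (simp only: power2_eq_iff)
  then obtain r where r: "r \<le> sqrt D" "2 * c\<^sup>2 + of_real (\<omega>\<^sup>2) = of_real r"
    using D by (metis of_real_minus order_refl real_sqrt_ge_zero neg_le_0_iff_le order_trans)
  have "D < (\<omega>\<^sup>2)\<^sup>2"
    unfolding D_def omega4 using kappa_pos mass_products_pos by (intro mult_strict_left_mono) auto
  then have "sqrt D < \<omega>\<^sup>2" by (metis real_sqrt_less_mono real_sqrt_abs abs_of_nonneg zero_le_power2)
  then have neg: "r - \<omega>\<^sup>2 < 0" using r by simp
  have "c\<^sup>2 + of_real ((sqrt ((\<omega>\<^sup>2 - r) / 2))\<^sup>2) = 0"
    using neg r(2) by (simp add: field_simps)
  with square_plus_square_nonzero[OF Re] show False by blast
qed

text \<open>Here \<open>c\<^sup>2\<close> has nonzero imaginary part, so its principal square root lies in the open right half-plane.\<close>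
lemma mode_root_unstable:
  assumes M: "(m0 + m1 + m2)\<^sup>2 < 27 * mass_products"
  obtains c where "mode_polynomial c = 0" "Re c > 0"
proof -
  define D where "D = \<kappa>\<^sup>2 * ((m0 + m1 + m2)\<^sup>2 - 27 * mass_products)"
  have D: "D < 0" using M kappa_pos unfolding D_def by (intro mult_pos_neg) auto
  define c where "c = csqrt ((\<i> * of_real (sqrt (- D)) - of_real (\<omega>\<^sup>2)) / 2)"
  have c2: "c\<^sup>2 = (\<i> * of_real (sqrt (- D)) - of_real (\<omega>\<^sup>2)) / 2" by (simp add: c_def)
  then have "2 * c\<^sup>2 + of_real (\<omega>\<^sup>2) = \<i> * of_real (sqrt (- D))" by (simp add: field_simps)
  then have "(2 * c\<^sup>2 + of_real (\<omega>\<^sup>2))\<^sup>2 = of_real D"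
    using D by (simp add: power_mult_distrib flip: of_real_power)
  then have "mode_polynomial c = 0" using char_discriminant[of c, folded D_def] by simp
  moreover have "Re c > 0"
  proof -
    have "Im (c\<^sup>2) \<noteq> 0" using D by (simp add: c2)
    then have "Re c \<noteq> 0" by (auto simp: power2_eq_square)
    moreover have "Re c \<ge> 0" using csqrt_principal unfolding c_def by (metis less_eq_real_def)
    ultimately show ?thesis by simp
  qed
  ultimately show ?thesis by (rule that)
qed

end

theorem proposition21:
  fixes G m0 m1 m2 A0 C0 A1 C1 A2 C2 l Z \<omega>0 x1 y1 x2 y2 :: real
    and ze :: state
  assumes "G > 0" "m0 > 0" "m1 > 0" "m2 > 0"
    and "A0 > 0" "C0 > 0" "A1 > 0" "C1 > 0" "A2 > 0" "C2 > 0"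
    and "C1 = A1" "C2 = A2"
    and "Z > 0"
    and "x1 = Z" "y1 = 0"
    and "x2 = Z * (m2 - m1) / (2 * (m1 + m2))"
    and "y2 = sqrt 3 * Z / 2 \<or> y2 = - (sqrt 3 * Z / 2)"
    and "\<omega>0\<^sup>2 = G * (m0 + m1 + m2) / Z ^ 3"
    and "blk ze Lam = vector [x1, y1, 0]"
    and "blk ze PLam = (m1 * m2 / (m1 + m2) * \<omega>0) *\<^sub>R vector [- y1, x1, 0]"
    and "blk ze Mu = vector [x2, y2, 0]"
    and "blk ze PMu = (m0 * (m1 + m2) / (m0 + m1 + m2) * \<omega>0) *\<^sub>R vector [- y2, x2, 0]"
    and "Omega_gyro A0 C0 l (blk ze Pi0) = vector [0, 0, \<omega>0]"
    and "blk ze Pi0 = vector [0, 0, C0 * \<omega>0 + l]"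
    and "blk ze Pi1 \<times> Omega_rigid A1 C1 (blk ze Pi1) = 0"
    and "blk ze Pi2 \<times> Omega_rigid A2 C2 (blk ze Pi2) = 0"
    and "relative_equilibrium (eq_motion G m0 m1 m2 A0 C0 A1 C1 A2 C2 l) ze"
    and "lagrangian A0 C0 l ze"
  shows "((m0 + m2 + m1)\<^sup>2 \<ge> 27 * (m1 * m0 + m2 * m0 + m1 * m2) \<longrightarrow>
           spectrally_stable (eq_motion G m0 m1 m2 A0 C0 A1 C1 A2 C2 l) ze) \<and>
         ((m0 + m2 + m1)\<^sup>2 < 27 * (m1 * m0 + m2 * m0 + m1 * m2) \<longrightarrow>
           \<not> spectrally_stable (eq_motion G m0 m1 m2 A0 C0 A1 C1 A2 C2 l) ze \<and>
           unstable (eq_motion G m0 m1 m2 A0 C0 A1 C1 A2 C2 l) ze)"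
proof -
  define \<eta> where "\<eta> = y2 / Z"
  have y2: "y2 = \<eta> * Z" using \<open>Z > 0\<close> by (simp add: \<eta>_def)
  interpret equilateral_configuration G m0 m1 m2 A0 C0 A1 A2 l Z \<omega>0 x2 \<eta> ze
  proof
    have "\<eta> = sqrt 3 / 2 \<or> \<eta> = - (sqrt 3 / 2)" using assms(13,17) by (auto simp: \<eta>_def)
    then have "\<eta>\<^sup>2 = (sqrt 3 / 2)\<^sup>2" by (metis power2_minus)
    then show "\<eta> * \<eta> = 3 / 4" by (simp add: power2_eq_square)
  qed (use assms y2 in simp_all)
  have C: "C1 = A1" "C2 = A2" by fact+
  have mass_products: "(m0 + m2 + m1)\<^sup>2 = (m0 + m1 + m2)\<^sup>2" "27 * (m1 * m0 + m2 * m0 + m1 * m2) = 27 * mass_products"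
    by (simp_all add: mass_products_def add_ac)
  have stable: "spectrally_stable field ze" if "(m0 + m1 + m2)\<^sup>2 \<ge> 27 * mass_products"
    unfolding spectrally_stable_def using eigenvalue_dichotomy mode_root_imaginary[OF that] by blast
  have unst: "\<not> spectrally_stable field ze \<and> unstable field ze" if M: "(m0 + m1 + m2)\<^sup>2 < 27 * mass_products"
  proof -
    obtain c where c: "mode_polynomial c = 0" "Re c > 0" by (rule mode_root_unstable[OF M])
    have ev: "eigenvalue (map_matrix complex_of_real (jacobian field ze)) c"
      by (rule mode_root_imp_eigenvalue[OF c(1)])
    have "field differentiable (at ze)"
      using has_derivative_eq_motion[OF collision_free_ze pos(7,8)] by (rule differentiableI)
    moreover have "field ze = 0"
      using \<open>relative_equilibrium (eq_motion G m0 m1 m2 A0 C0 A1 C1 A2 C2 l) ze\<close>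
      unfolding C relative_equilibrium_def .
    ultimately have "unstable field ze" using ev c(2) by (rule unstable_if_eigenvalue_Re_pos)
    moreover have "\<not> spectrally_stable field ze" using ev c(2) unfolding spectrally_stable_def by force
    ultimately show ?thesis by blast
  qed
  show ?thesis unfolding C mass_products using stable unst by blast
qed

end
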